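(* Fix $k\ge 2$. Over ${\sf RCA}_0$, the following are equivalent: (1) ${\sf ACA}_0$. (2) Suppose $H$ is a hypergraph with finite edges given by a sequence of characteristic functions. If every finite partial hypergraph of $H$ has a proper $k$-coloring, then $H$ has a proper $k$-coloring. (3) Statement (2) with "proper" replaced by "conflict-free".
   Context: ${\sf RCA}_0$ is the base system of second order arithmetic; ${\sf ACA}_0$ is ${\sf RCA}_0$ plus arithmetical comprehension. A hypergraph consists of a vertex set $V\subseteq\mathbb{N}$ and edges which are subsets of $V$; here the edges are all finite and are given by a sequence $\langle\chi_i\rangle_{i\in\mathbb{N}}$ of characteristic functions ($\chi_i(v)=1$ iff $v$ is in the $i$-th edge). A partial hypergraph of $H$ consists of a subset $V'$ of the vertices of $H$ and a subset $E'$ of the edges of $H$ such that every $e\in E'$ satisfies $e\subseteq V'$; it is finite if $V'$ and $E'$ are finite. A vertex coloring is a map $\chi:V\to\mathbb{N}$; it is a $k$-coloring if its range is contained in $\{0,\dots,k-1\}$; proper if non-constant on each edge containing more than one vertex; conflict-free if every edge $e$ contains a vertex whose color is shared by no other vertex of $e$, i.e. $\forall e\,\exists j\ |\{v\in e:\chi(v)=j\}|=1$. *)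

theory Defs
  imports Main
begin

section \<open>The language of second order arithmetic\<close>

text \<open>Number variables and set variables are both named by strings but form separate
  namespaces.\<close>

datatype l2_tm =
    NVar string
  | Zero (\<open>\<^bold>0\<close>)
  | One (\<open>\<^bold>1\<close>)
  | Plus l2_tm l2_tm (infixl \<open>\<^bold>+\<close> 65)
  | Times l2_tm l2_tm (infixl \<open>\<^bold>*\<close> 70)

datatype l2_fm =
    Eq l2_tm l2_tm (infix \<open>\<^bold>=\<close> 50)
  | Less l2_tm l2_tm (infix \<open>\<^bold><\<close> 50)
  | Mem l2_tm string (infix \<open>\<^bold>\<in>\<close> 50)
  | Neg l2_fm (\<open>\<^bold>\<not> _\<close> [40] 40)
  | Conj l2_fm l2_fm (infixr \<open>\<^bold>\<and>\<close> 35)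
  | Disj l2_fm l2_fm (infixr \<open>\<^bold>\<or>\<close> 30)
  | Imp l2_fm l2_fm (infixr \<open>\<^bold>\<longrightarrow>\<close> 25)
  | Iff l2_fm l2_fm (infixr \<open>\<^bold>\<longleftrightarrow>\<close> 25)
  | AllN string l2_fm (\<open>(3\<^bold>\<forall>_./ _)\<close> [1000, 10] 10)
  | ExN string l2_fm (\<open>(3\<^bold>\<exists>_./ _)\<close> [1000, 10] 10)
  | AllS string l2_fm (\<open>(3\<^bold>\<forall>\<^sub>2_./ _)\<close> [1000, 10] 10)
  | ExS string l2_fm (\<open>(3\<^bold>\<exists>\<^sub>2_./ _)\<close> [1000, 10] 10)

fun tm_vars :: "l2_tm \<Rightarrow> string set" where
  "tm_vars (NVar x) = {x}"
| "tm_vars \<^bold>0 = {}"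
| "tm_vars \<^bold>1 = {}"
| "tm_vars (s \<^bold>+ t) = tm_vars s \<union> tm_vars t"
| "tm_vars (s \<^bold>* t) = tm_vars s \<union> tm_vars t"

fun free_svars :: "l2_fm \<Rightarrow> string set" where
  "free_svars (s \<^bold>= t) = {}"
| "free_svars (s \<^bold>< t) = {}"
| "free_svars (t \<^bold>\<in> X) = {X}"
| "free_svars (\<^bold>\<not> p) = free_svars p"
| "free_svars (p \<^bold>\<and> q) = free_svars p \<union> free_svars q"
| "free_svars (p \<^bold>\<or> q) = free_svars p \<union> free_svars q"
| "free_svars (p \<^bold>\<longrightarrow> q) = free_svars p \<union> free_svars q"
| "free_svars (p \<^bold>\<longleftrightarrow> q) = free_svars p \<union> free_svars q"
| "free_svars (\<^bold>\<forall>x. p) = free_svars p"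
| "free_svars (\<^bold>\<exists>x. p) = free_svars p"
| "free_svars (\<^bold>\<forall>\<^sub>2X. p) = free_svars p - {X}"
| "free_svars (\<^bold>\<exists>\<^sub>2X. p) = free_svars p - {X}"

text \<open>Substitution of \<open>r\<close> for the free occurrences of the number variable \<open>y\<close>, without renaming
  of bound variables. It is capture-free whenever \<open>r\<close> contains no variable other than \<open>y\<close>; it is
  used below only with \<open>r = 0\<close> and \<open>r = y + 1\<close>.\<close>

fun subst_tm :: "string \<Rightarrow> l2_tm \<Rightarrow> l2_tm \<Rightarrow> l2_tm" where
  "subst_tm y r (NVar x) = (if x = y then r else NVar x)"
| "subst_tm y r \<^bold>0 = \<^bold>0"
| "subst_tm y r \<^bold>1 = \<^bold>1"
| "subst_tm y r (s \<^bold>+ t) = subst_tm y r s \<^bold>+ subst_tm y r t"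
| "subst_tm y r (s \<^bold>* t) = subst_tm y r s \<^bold>* subst_tm y r t"

fun subst :: "string \<Rightarrow> l2_tm \<Rightarrow> l2_fm \<Rightarrow> l2_fm" where
  "subst y r (s \<^bold>= t) = (subst_tm y r s \<^bold>= subst_tm y r t)"
| "subst y r (s \<^bold>< t) = (subst_tm y r s \<^bold>< subst_tm y r t)"
| "subst y r (t \<^bold>\<in> X) = (subst_tm y r t \<^bold>\<in> X)"
| "subst y r (\<^bold>\<not> p) = (\<^bold>\<not> subst y r p)"
| "subst y r (p \<^bold>\<and> q) = (subst y r p \<^bold>\<and> subst y r q)"
| "subst y r (p \<^bold>\<or> q) = (subst y r p \<^bold>\<or> subst y r q)"
| "subst y r (p \<^bold>\<longrightarrow> q) = (subst y r p \<^bold>\<longrightarrow> subst y r q)"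
| "subst y r (p \<^bold>\<longleftrightarrow> q) = (subst y r p \<^bold>\<longleftrightarrow> subst y r q)"
| "subst y r (\<^bold>\<forall>x. p) = (\<^bold>\<forall>x. if x = y then p else subst y r p)"
| "subst y r (\<^bold>\<exists>x. p) = (\<^bold>\<exists>x. if x = y then p else subst y r p)"
| "subst y r (\<^bold>\<forall>\<^sub>2X. p) = (\<^bold>\<forall>\<^sub>2X. subst y r p)"
| "subst y r (\<^bold>\<exists>\<^sub>2X. p) = (\<^bold>\<exists>\<^sub>2X. subst y r p)"

inductive Sigma00 :: "l2_fm \<Rightarrow> bool" where
  "Sigma00 (s \<^bold>= t)"
| "Sigma00 (s \<^bold>< t)"
| "Sigma00 (t \<^bold>\<in> X)"
| "Sigma00 p \<Longrightarrow> Sigma00 (\<^bold>\<not> p)"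
| "Sigma00 p \<Longrightarrow> Sigma00 q \<Longrightarrow> Sigma00 (p \<^bold>\<and> q)"
| "Sigma00 p \<Longrightarrow> Sigma00 q \<Longrightarrow> Sigma00 (p \<^bold>\<or> q)"
| "Sigma00 p \<Longrightarrow> Sigma00 q \<Longrightarrow> Sigma00 (p \<^bold>\<longrightarrow> q)"
| "Sigma00 p \<Longrightarrow> Sigma00 q \<Longrightarrow> Sigma00 (p \<^bold>\<longleftrightarrow> q)"
| "Sigma00 p \<Longrightarrow> x \<notin> tm_vars t \<Longrightarrow> Sigma00 (\<^bold>\<forall>x. NVar x \<^bold>< t \<^bold>\<longrightarrow> p)"
| "Sigma00 p \<Longrightarrow> x \<notin> tm_vars t \<Longrightarrow> Sigma00 (\<^bold>\<exists>x. NVar x \<^bold>< t \<^bold>\<and> p)"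

definition Sigma01 :: "l2_fm \<Rightarrow> bool" where
  "Sigma01 p \<longleftrightarrow> (\<exists>x q. Sigma00 q \<and> p = (\<^bold>\<exists>x. q))"

definition Pi01 :: "l2_fm \<Rightarrow> bool" where
  "Pi01 p \<longleftrightarrow> (\<exists>x q. Sigma00 q \<and> p = (\<^bold>\<forall>x. q))"

fun arithmetical :: "l2_fm \<Rightarrow> bool" where
  "arithmetical (s \<^bold>= t) = True"
| "arithmetical (s \<^bold>< t) = True"
| "arithmetical (t \<^bold>\<in> X) = True"
| "arithmetical (\<^bold>\<not> p) = arithmetical p"
| "arithmetical (p \<^bold>\<and> q) = (arithmetical p \<and> arithmetical q)"
| "arithmetical (p \<^bold>\<or> q) = (arithmetical p \<and> arithmetical q)"
| "arithmetical (p \<^bold>\<longrightarrow> q) = (arithmetical p \<and> arithmetical q)"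
| "arithmetical (p \<^bold>\<longleftrightarrow> q) = (arithmetical p \<and> arithmetical q)"
| "arithmetical (\<^bold>\<forall>x. p) = arithmetical p"
| "arithmetical (\<^bold>\<exists>x. p) = arithmetical p"
| "arithmetical (\<^bold>\<forall>\<^sub>2X. p) = False"
| "arithmetical (\<^bold>\<exists>\<^sub>2X. p) = False"


section \<open>Structures and satisfaction\<close>

text \<open>The number universe is the whole type \<open>'a\<close>; set variables range over \<open>sets_of M\<close>, which
  need not be the full power set.\<close>

record 'a l2_struct =
  zero_of :: 'a
  one_of :: 'a
  plus_of :: "'a \<Rightarrow> 'a \<Rightarrow> 'a"
  times_of :: "'a \<Rightarrow> 'a \<Rightarrow> 'a"
  less_of :: "'a \<Rightarrow> 'a \<Rightarrow> bool"
  sets_of :: "'a set set"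

definition l2_structure :: "'a l2_struct \<Rightarrow> bool" where
  "l2_structure M \<longleftrightarrow> sets_of M \<noteq> {}"

fun tm_val :: "'a l2_struct \<Rightarrow> (string \<Rightarrow> 'a) \<Rightarrow> l2_tm \<Rightarrow> 'a" where
  "tm_val M e (NVar x) = e x"
| "tm_val M e \<^bold>0 = zero_of M"
| "tm_val M e \<^bold>1 = one_of M"
| "tm_val M e (s \<^bold>+ t) = plus_of M (tm_val M e s) (tm_val M e t)"
| "tm_val M e (s \<^bold>* t) = times_of M (tm_val M e s) (tm_val M e t)"

fun sat :: "'a l2_struct \<Rightarrow> (string \<Rightarrow> 'a) \<Rightarrow> (string \<Rightarrow> 'a set) \<Rightarrow> l2_fm \<Rightarrow> bool" where
  "sat M e S (s \<^bold>= t) \<longleftrightarrow> tm_val M e s = tm_val M e t"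
| "sat M e S (s \<^bold>< t) \<longleftrightarrow> less_of M (tm_val M e s) (tm_val M e t)"
| "sat M e S (t \<^bold>\<in> X) \<longleftrightarrow> tm_val M e t \<in> S X"
| "sat M e S (\<^bold>\<not> p) \<longleftrightarrow> \<not> sat M e S p"
| "sat M e S (p \<^bold>\<and> q) \<longleftrightarrow> sat M e S p \<and> sat M e S q"
| "sat M e S (p \<^bold>\<or> q) \<longleftrightarrow> sat M e S p \<or> sat M e S q"
| "sat M e S (p \<^bold>\<longrightarrow> q) \<longleftrightarrow> (sat M e S p \<longrightarrow> sat M e S q)"
| "sat M e S (p \<^bold>\<longleftrightarrow> q) \<longleftrightarrow> (sat M e S p \<longleftrightarrow> sat M e S q)"
| "sat M e S (\<^bold>\<forall>x. p) \<longleftrightarrow> (\<forall>a. sat M (e(x := a)) S p)"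
| "sat M e S (\<^bold>\<exists>x. p) \<longleftrightarrow> (\<exists>a. sat M (e(x := a)) S p)"
| "sat M e S (\<^bold>\<forall>\<^sub>2X. p) \<longleftrightarrow> (\<forall>A\<in>sets_of M. sat M e (S(X := A)) p)"
| "sat M e S (\<^bold>\<exists>\<^sub>2X. p) \<longleftrightarrow> (\<exists>A\<in>sets_of M. sat M e (S(X := A)) p)"

text \<open>Truth of the universal closure.\<close>

definition true_in :: "'a l2_struct \<Rightarrow> l2_fm \<Rightarrow> bool" (infix \<open>\<Turnstile>\<close> 50) where
  "M \<Turnstile> p \<longleftrightarrow> (\<forall>e S. (\<forall>X. S X \<in> sets_of M) \<longrightarrow> sat M e S p)"

definition models :: "'a l2_struct \<Rightarrow> l2_fm set \<Rightarrow> bool" (infix \<open>\<TTurnstile>\<close> 50) where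
  "M \<TTurnstile> T \<longleftrightarrow> (\<forall>p\<in>T. M \<Turnstile> p)"


section \<open>The axiom systems\<close>

definition basic_axioms :: "l2_fm set" where
  "basic_axioms = (let m = NVar ''m''; n = NVar ''n'' in
    {\<^bold>\<not> n \<^bold>+ \<^bold>1 \<^bold>= \<^bold>0,
     m \<^bold>+ \<^bold>1 \<^bold>= n \<^bold>+ \<^bold>1 \<^bold>\<longrightarrow> m \<^bold>= n,
     m \<^bold>+ \<^bold>0 \<^bold>= m,
     m \<^bold>+ (n \<^bold>+ \<^bold>1) \<^bold>= (m \<^bold>+ n) \<^bold>+ \<^bold>1,
     m \<^bold>* \<^bold>0 \<^bold>= \<^bold>0,
     m \<^bold>* (n \<^bold>+ \<^bold>1) \<^bold>= (m \<^bold>* n) \<^bold>+ m,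
     \<^bold>\<not> m \<^bold>< \<^bold>0,
     m \<^bold>< n \<^bold>+ \<^bold>1 \<^bold>\<longleftrightarrow> m \<^bold>< n \<^bold>\<or> m \<^bold>= n})"

definition induction_axiom :: "string \<Rightarrow> l2_fm \<Rightarrow> l2_fm" where
  "induction_axiom x p =
    (subst x \<^bold>0 p \<^bold>\<and> (\<^bold>\<forall>x. p \<^bold>\<longrightarrow> subst x (NVar x \<^bold>+ \<^bold>1) p) \<^bold>\<longrightarrow> (\<^bold>\<forall>x. p))"

definition comprehension_axiom :: "string \<Rightarrow> string \<Rightarrow> l2_fm \<Rightarrow> l2_fm" where
  "comprehension_axiom X x p = (\<^bold>\<exists>\<^sub>2X. \<^bold>\<forall>x. NVar x \<^bold>\<in> X \<^bold>\<longleftrightarrow> p)"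

definition RCA0 :: "l2_fm set" where
  "RCA0 = basic_axioms
    \<union> {induction_axiom x p | x p. Sigma01 p}
    \<union> {(\<^bold>\<forall>x. p \<^bold>\<longleftrightarrow> q) \<^bold>\<longrightarrow> comprehension_axiom X x p | X x p q.
         Sigma01 p \<and> Pi01 q \<and> X \<notin> free_svars p}"

definition ACA0 :: "l2_fm set" where
  "ACA0 = RCA0 \<union> {comprehension_axiom X x p | X x p. arithmetical p \<and> X \<notin> free_svars p}"


section \<open>Hypergraphs and colorings inside second order arithmetic\<close>

text \<open>All formulas of this section use the following set variables. \<open>V\<close> is the vertex set and
  \<open>C\<close> the sequence of characteristic functions, a function from \<open>\<nat> \<times> \<nat>\<close> to \<open>{0, 1}\<close> sending
  \<open>(i, v)\<close> to \<open>\<chi>\<^sub>i(v)\<close>; \<open>W\<close> and \<open>E\<close> are the vertex set and the set of edge indices of a partial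
  hypergraph; \<open>F\<close> is a coloring. Functions are sets of coded pairs.\<close>

fun numeral_tm :: "nat \<Rightarrow> l2_tm" where
  "numeral_tm 0 = \<^bold>0"
| "numeral_tm (Suc n) = numeral_tm n \<^bold>+ \<^bold>1"

text \<open>The usual pairing \<open>(s, t) = (s + t)\<^sup>2 + s\<close> of second order arithmetic.\<close>

definition pair_tm :: "l2_tm \<Rightarrow> l2_tm \<Rightarrow> l2_tm" (\<open>\<^bold>\<langle>_,/ _\<^bold>\<rangle>\<close>) where
  "\<^bold>\<langle>s, t\<^bold>\<rangle> = (s \<^bold>+ t) \<^bold>* (s \<^bold>+ t) \<^bold>+ s"

definition finite_fm :: "string \<Rightarrow> l2_fm" where
  "finite_fm X = (\<^bold>\<exists>''b''. \<^bold>\<forall>''n''. NVar ''n'' \<^bold>\<in> X \<^bold>\<longrightarrow> NVar ''n'' \<^bold>< NVar ''b'')"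

definition subset_fm :: "string \<Rightarrow> string \<Rightarrow> l2_fm" where
  "subset_fm X Y = (\<^bold>\<forall>''n''. NVar ''n'' \<^bold>\<in> X \<^bold>\<longrightarrow> NVar ''n'' \<^bold>\<in> Y)"

definition function_on_fm :: "string \<Rightarrow> string \<Rightarrow> l2_fm" where
  "function_on_fm F X = (let p = NVar ''p''; x = NVar ''x''; y = NVar ''y''; z = NVar ''z'' in
     (\<^bold>\<forall>''p''. p \<^bold>\<in> F \<^bold>\<longrightarrow> (\<^bold>\<exists>''x''. \<^bold>\<exists>''y''. x \<^bold>\<in> X \<^bold>\<and> p \<^bold>= \<^bold>\<langle>x, y\<^bold>\<rangle>)) \<^bold>\<and>
     (\<^bold>\<forall>''x''. x \<^bold>\<in> X \<^bold>\<longrightarrow>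
       (\<^bold>\<exists>''y''. \<^bold>\<langle>x, y\<^bold>\<rangle> \<^bold>\<in> F \<^bold>\<and> (\<^bold>\<forall>''z''. \<^bold>\<langle>x, z\<^bold>\<rangle> \<^bold>\<in> F \<^bold>\<longrightarrow> z \<^bold>= y))))"

definition char_sequence_fm :: l2_fm where
  "char_sequence_fm = (let p = NVar ''p''; i = NVar ''i''; v = NVar ''v''; y = NVar ''y'';
      z = NVar ''z'' in
     (\<^bold>\<forall>''p''. p \<^bold>\<in> ''C'' \<^bold>\<longrightarrow>
       (\<^bold>\<exists>''i''. \<^bold>\<exists>''v''. \<^bold>\<exists>''y''. p \<^bold>= \<^bold>\<langle>\<^bold>\<langle>i, v\<^bold>\<rangle>, y\<^bold>\<rangle> \<^bold>\<and> (y \<^bold>= \<^bold>0 \<^bold>\<or> y \<^bold>= \<^bold>1))) \<^bold>\<and>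
     (\<^bold>\<forall>''i''. \<^bold>\<forall>''v''. \<^bold>\<exists>''y''. \<^bold>\<langle>\<^bold>\<langle>i, v\<^bold>\<rangle>, y\<^bold>\<rangle> \<^bold>\<in> ''C'' \<^bold>\<and>
       (\<^bold>\<forall>''z''. \<^bold>\<langle>\<^bold>\<langle>i, v\<^bold>\<rangle>, z\<^bold>\<rangle> \<^bold>\<in> ''C'' \<^bold>\<longrightarrow> z \<^bold>= y)))"

text \<open>\<open>v\<close> lies in the \<open>i\<close>-th edge, i.e.\ \<open>\<chi>\<^sub>i(v) = 1\<close>.\<close>

definition in_edge_fm :: "l2_tm \<Rightarrow> l2_tm \<Rightarrow> l2_fm" where
  "in_edge_fm v i = (\<^bold>\<langle>\<^bold>\<langle>i, v\<^bold>\<rangle>, \<^bold>1\<^bold>\<rangle> \<^bold>\<in> ''C'')"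

definition color_fm :: "l2_tm \<Rightarrow> l2_tm \<Rightarrow> l2_fm" where
  "color_fm v c = (\<^bold>\<langle>v, c\<^bold>\<rangle> \<^bold>\<in> ''F'')"

definition hypergraph_fm :: l2_fm where
  "hypergraph_fm = (let i = NVar ''i''; v = NVar ''v''; b = NVar ''b'' in
     char_sequence_fm \<^bold>\<and>
     (\<^bold>\<forall>''i''. \<^bold>\<forall>''v''. in_edge_fm v i \<^bold>\<longrightarrow> v \<^bold>\<in> ''V'') \<^bold>\<and>
     (\<^bold>\<forall>''i''. \<^bold>\<exists>''b''. \<^bold>\<forall>''v''. in_edge_fm v i \<^bold>\<longrightarrow> v \<^bold>< b))"

definition finite_partial_hypergraph_fm :: l2_fm where
  "finite_partial_hypergraph_fm = (let i = NVar ''i''; v = NVar ''v'' in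
     subset_fm ''W'' ''V'' \<^bold>\<and> finite_fm ''W'' \<^bold>\<and> finite_fm ''E'' \<^bold>\<and>
     (\<^bold>\<forall>''i''. i \<^bold>\<in> ''E'' \<^bold>\<longrightarrow> (\<^bold>\<forall>''v''. in_edge_fm v i \<^bold>\<longrightarrow> v \<^bold>\<in> ''W'')))"

definition k_coloring_fm :: "nat \<Rightarrow> string \<Rightarrow> l2_fm" where
  "k_coloring_fm k X = (function_on_fm ''F'' X \<^bold>\<and>
     (\<^bold>\<forall>''v''. \<^bold>\<forall>''c''. color_fm (NVar ''v'') (NVar ''c'') \<^bold>\<longrightarrow> NVar ''c'' \<^bold>< numeral_tm k))"

text \<open>The requirements that proper and conflict-free colorings impose on a single edge, whose
  index is the free number variable \<open>i\<close>.\<close>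

definition proper_edge_fm :: l2_fm where
  "proper_edge_fm = (let i = NVar ''i''; u = NVar ''u''; v = NVar ''v''; c = NVar ''c'';
      d = NVar ''d'' in
     (\<^bold>\<exists>''u''. \<^bold>\<exists>''v''. in_edge_fm u i \<^bold>\<and> in_edge_fm v i \<^bold>\<and> \<^bold>\<not> u \<^bold>= v) \<^bold>\<longrightarrow>
     (\<^bold>\<exists>''u''. \<^bold>\<exists>''v''. \<^bold>\<exists>''c''. \<^bold>\<exists>''d''. in_edge_fm u i \<^bold>\<and> in_edge_fm v i \<^bold>\<and>
       color_fm u c \<^bold>\<and> color_fm v d \<^bold>\<and> \<^bold>\<not> c \<^bold>= d))"

definition conflict_free_edge_fm :: l2_fm where
  "conflict_free_edge_fm = (let i = NVar ''i''; j = NVar ''j''; u = NVar ''u''; v = NVar ''v'' in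
     \<^bold>\<exists>''j''. \<^bold>\<exists>''v''. in_edge_fm v i \<^bold>\<and> color_fm v j \<^bold>\<and>
       (\<^bold>\<forall>''u''. in_edge_fm u i \<^bold>\<and> color_fm u j \<^bold>\<longrightarrow> u \<^bold>= v))"

definition compactness_fm :: "nat \<Rightarrow> l2_fm \<Rightarrow> l2_fm" where
  "compactness_fm k good_edge =
    (\<^bold>\<forall>\<^sub>2''V''. \<^bold>\<forall>\<^sub>2''C''. hypergraph_fm \<^bold>\<longrightarrow>
      (\<^bold>\<forall>\<^sub>2''W''. \<^bold>\<forall>\<^sub>2''E''. finite_partial_hypergraph_fm \<^bold>\<longrightarrow>
        (\<^bold>\<exists>\<^sub>2''F''. k_coloring_fm k ''W'' \<^bold>\<and> (\<^bold>\<forall>''i''. NVar ''i'' \<^bold>\<in> ''E'' \<^bold>\<longrightarrow> good_edge))) \<^bold>\<longrightarrow>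
      (\<^bold>\<exists>\<^sub>2''F''. k_coloring_fm k ''V'' \<^bold>\<and> (\<^bold>\<forall>''i''. good_edge)))"

definition proper_compactness :: "nat \<Rightarrow> l2_fm" where
  "proper_compactness k = compactness_fm k proper_edge_fm"

definition conflict_free_compactness :: "nat \<Rightarrow> l2_fm" where
  "conflict_free_compactness k = compactness_fm k conflict_free_edge_fm"

end

theory Submission
  imports Defs
begin

text \<open>
  \<open>ACA\<^sub>0\<close> implies compactness: finite colorings are coded by numbers, so the colorings of the
  initial segments of the hypergraph form a tree of codes, and arithmetical comprehension defines
  its leftmost path.

  Conversely, let \<open>D\<close> be a partial function; \<open>\<Sigma>\<^sup>0\<^sub>1\<close> comprehension, and with it all of arithmetical
  comprehension, amounts to the existence of the domains of such \<open>D\<close>. Take a clique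
  \<open>x\<^sub>0, \<dots>, x\<^sub>k\<^sub>-\<^sub>1\<close> and a vertex \<open>u\<^sub>n\<close> for every number \<open>n\<close>. The edge \<open>{u\<^sub>n, x\<^sub>0}\<close> keeps the color of
  \<open>u\<^sub>n\<close> away from that of \<open>x\<^sub>0\<close>, but as soon as a value \<open>D(n) = s\<close> shows up, this edge receives a new
  third vertex, which makes it harmless, and the edges \<open>{u\<^sub>n, x\<^sub>i}\<close> with \<open>i > 0\<close> are added. Hence
  \<open>n\<close> lies in the domain of \<open>D\<close> iff \<open>u\<^sub>n\<close> and \<open>x\<^sub>0\<close> have the same color. The third vertex enters a
  set that is given by its characteristic function only, so the hypergraph is computable from \<open>D\<close>.
  Edges with at most three vertices make proper and conflict-free colorings coincide.
\<close>

section \<open>Satisfaction\<close>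

text \<open>The model may be nonstandard: arithmetic has to be derived inside it, properties can be
  proved by induction only once their extensions are known to be sets of the model, and "finite"
  means bounded by an element. Only \<open>k\<close> is a genuine natural number, so counting colors
  with \<open>card\<close> is legitimate. The obstacle in the reversal is that finite parts must be
  colored without arithmetical comprehension, although membership of \<open>n\<close> in the domain
  of \<open>D\<close> cannot be decided there. Hence the index of an edge forcing \<open>u_n\<close>
  away from \<open>x_i\<close> contains the value \<open>s\<close> itself: edges with indices below
  \<open>b\<close> mention only values \<open>s < b\<close>, and searching for those is a bounded
  quantifier. A test edge whose third vertex comes from a later value causes no conflict, because
  third vertices always get color 1 and then \<open>x_0\<close> alone has color 0. In the other
  direction the unbounded step is to decide which finite codes extend to all levels; once these form
  a set, so does the leftmost choice among them.\<close>

fun nvars :: "l2_fm \<Rightarrow> string set" where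
  "nvars (s \<^bold>= t) = tm_vars s \<union> tm_vars t"
| "nvars (s \<^bold>< t) = tm_vars s \<union> tm_vars t"
| "nvars (t \<^bold>\<in> X) = tm_vars t"
| "nvars (\<^bold>\<not> p) = nvars p"
| "nvars (p \<^bold>\<and> q) = nvars p \<union> nvars q"
| "nvars (p \<^bold>\<or> q) = nvars p \<union> nvars q"
| "nvars (p \<^bold>\<longrightarrow> q) = nvars p \<union> nvars q"
| "nvars (p \<^bold>\<longleftrightarrow> q) = nvars p \<union> nvars q"
| "nvars (\<^bold>\<forall>x. p) = insert x (nvars p)"
| "nvars (\<^bold>\<exists>x. p) = insert x (nvars p)"
| "nvars (\<^bold>\<forall>\<^sub>2X. p) = nvars p"
| "nvars (\<^bold>\<exists>\<^sub>2X. p) = nvars p"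

lemma finite_tm_vars [simp]: "finite (tm_vars t)"
  by (induction t) auto

lemma finite_nvars [simp]: "finite (nvars p)"
  by (induction p) auto

lemma finite_free_svars [simp]: "finite (free_svars p)"
  by (induction p) auto

lemma fresh_string:
  assumes "finite A"
  obtains x :: string where "x \<notin> A"
  using assms infinite_UNIV_listI ex_new_if_finite by metis

lemma tm_val_cong: "(\<And>x. x \<in> tm_vars t \<Longrightarrow> e x = e' x) \<Longrightarrow> tm_val M e t = tm_val M e' t"
  by (induction t) auto

lemma sat_cong:
  assumes "\<And>x. x \<in> nvars p \<Longrightarrow> e x = e' x" "\<And>X. X \<in> free_svars p \<Longrightarrow> S X = S' X"
  shows "sat M e S p \<longleftrightarrow> sat M e' S' p"
  using assms
proof (induction p arbitrary: e e' S S')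
  case (Eq s t)
  then have "tm_val M e s = tm_val M e' s" "tm_val M e t = tm_val M e' t"
    by (auto intro: tm_val_cong)
  then show ?case by simp
next
  case (Less s t)
  then have "tm_val M e s = tm_val M e' s" "tm_val M e t = tm_val M e' t"
    by (auto intro: tm_val_cong)
  then show ?case by simp
next
  case (Mem t X)
  then have "tm_val M e t = tm_val M e' t"
    by (auto intro: tm_val_cong)
  then show ?case using Mem by simp
next
  case (Neg p)
  have "sat M e S p = sat M e' S' p"
    by (rule Neg.IH) (use Neg.prems in auto)
  then show ?case by simp
next
  case (Conj p q)
  have "sat M e S p = sat M e' S' p" "sat M e S q = sat M e' S' q"
    by (rule Conj.IH; use Conj.prems in auto)+
  then show ?case by simp
next
  case (Disj p q)
  have "sat M e S p = sat M e' S' p" "sat M e S q = sat M e' S' q"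
    by (rule Disj.IH; use Disj.prems in auto)+
  then show ?case by simp
next
  case (Imp p q)
  have "sat M e S p = sat M e' S' p" "sat M e S q = sat M e' S' q"
    by (rule Imp.IH; use Imp.prems in auto)+
  then show ?case by simp
next
  case (Iff p q)
  have "sat M e S p = sat M e' S' p" "sat M e S q = sat M e' S' q"
    by (rule Iff.IH; use Iff.prems in auto)+
  then show ?case by simp
next
  case (AllN x p)
  have "sat M (e(x := a)) S p = sat M (e'(x := a)) S' p" for a
    by (rule AllN.IH) (use AllN.prems in auto)
  then show ?case by simp
next
  case (ExN x p)
  have "sat M (e(x := a)) S p = sat M (e'(x := a)) S' p" for a
    by (rule ExN.IH) (use ExN.prems in auto)
  then show ?case by simp
next
  case (AllS X p)
  have "sat M e (S(X := A)) p = sat M e' (S'(X := A)) p" for A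
    by (rule AllS.IH) (use AllS.prems in auto)
  then show ?case by simp
next
  case (ExS X p)
  have "sat M e (S(X := A)) p = sat M e' (S'(X := A)) p" for A
    by (rule ExS.IH) (use ExS.prems in auto)
  then show ?case by simp
qed

lemma sat_fresh_nvar: "x \<notin> nvars p \<Longrightarrow> sat M (e(x := a)) S p \<longleftrightarrow> sat M e S p"
  by (rule sat_cong) auto

lemma sat_fresh_svar: "X \<notin> free_svars p \<Longrightarrow> sat M e (S(X := A)) p \<longleftrightarrow> sat M e S p"
  by (rule sat_cong) auto

section \<open>Terms for tuples and blocks of bounded quantifiers\<close>

lemma tm_vars_pair [simp]: "tm_vars \<^bold>\<langle>s, t\<^bold>\<rangle> = tm_vars s \<union> tm_vars t"
  by (auto simp: pair_tm_def)

lemma tm_vars_numeral [simp]: "tm_vars (numeral_tm n) = {}"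
  by (induction n) auto

text \<open>Collapses the parameters of a formula into one number, so that a single set of the model
  can record its truth for all values of the parameters.\<close>

fun tuple_tm :: "string list \<Rightarrow> l2_tm" where
  "tuple_tm [] = \<^bold>0"
| "tuple_tm (x # xs) = \<^bold>\<langle>NVar x, tuple_tm xs\<^bold>\<rangle>"

lemma tm_vars_tuple [simp]: "tm_vars (tuple_tm xs) = set xs"
  by (induction xs) auto

text \<open>The bound is \<open>z + 1\<close> because a component can equal the pair that contains
  it, for instance when the pair is 0.\<close>

fun bex_fm :: "string \<Rightarrow> string list \<Rightarrow> l2_fm \<Rightarrow> l2_fm" where
  "bex_fm z [] p = p"
| "bex_fm z (x # xs) p = (\<^bold>\<exists>x. NVar x \<^bold>< NVar z \<^bold>+ \<^bold>1 \<^bold>\<and> bex_fm z xs p)"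

lemma Sigma00_bex: "Sigma00 p \<Longrightarrow> z \<notin> set xs \<Longrightarrow> Sigma00 (bex_fm z xs p)"
  by (induction xs) (auto intro!: Sigma00.intros)

section \<open>Arithmetic in a model of \<open>RCA\<^sub>0\<close>\<close>

locale rca0 =
  fixes M :: "'a l2_struct"
  assumes nonempty: "l2_structure M" and RCA0: "M \<TTurnstile> RCA0"
begin

abbreviation zero (\<open>\<zero>\<close>) where "\<zero> \<equiv> zero_of M"
abbreviation one (\<open>\<one>\<close>) where "\<one> \<equiv> one_of M"
abbreviation plus (infixl \<open>\<oplus>\<close> 65) where "a \<oplus> b \<equiv> plus_of M a b"
abbreviation times (infixl \<open>\<otimes>\<close> 70) where "a \<otimes> b \<equiv> times_of M a b"
abbreviation less (infix \<open>\<prec>\<close> 50) where "a \<prec> b \<equiv> less_of M a b"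
abbreviation \<S> where "\<S> \<equiv> sets_of M"

lemma comprehension_instance:
  assumes "M \<Turnstile> comprehension_axiom X x p" "X \<notin> free_svars p" "\<And>X. S X \<in> \<S>"
  shows "{a. sat M (e(x := a)) S p} \<in> \<S>"
proof -
  have "sat M e S (comprehension_axiom X x p)"
    using assms(1,3) by (simp add: true_in_def)
  then obtain A where A: "A \<in> \<S>" "\<And>a. a \<in> A \<longleftrightarrow> sat M (e(x := a)) (S(X := A)) p"
    by (auto simp: comprehension_axiom_def)
  then have "A = {a. sat M (e(x := a)) S p}"
    using assms(2) by (auto simp: sat_fresh_svar)
  with A(1) show ?thesis by simp
qed

text \<open>Under a vacuous quantifier over a fresh variable a bounded formula becomes both Sigma01
  and Pi01, so recursive comprehension applies to it.\<close>

lemma Sigma00_comprehension: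
  assumes "Sigma00 p" "\<And>X. S X \<in> \<S>"
  shows "{a. sat M (e(x := a)) S p} \<in> \<S>"
proof -
  obtain w where w: "w \<notin> insert x (nvars p)"
    using fresh_string[of "insert x (nvars p)"] by auto
  obtain X where X: "X \<notin> free_svars p"
    using fresh_string[of "free_svars p"] by auto
  have "Sigma01 (\<^bold>\<exists>w. p)" "Pi01 (\<^bold>\<forall>w. p)"
    using assms by (auto simp: Sigma01_def Pi01_def)
  then have "((\<^bold>\<forall>x. (\<^bold>\<exists>w. p) \<^bold>\<longleftrightarrow> (\<^bold>\<forall>w. p)) \<^bold>\<longrightarrow> comprehension_axiom X x (\<^bold>\<exists>w. p)) \<in> RCA0"
    using X unfolding RCA0_def by force
  then have *: "M \<Turnstile> ((\<^bold>\<forall>x. (\<^bold>\<exists>w. p) \<^bold>\<longleftrightarrow> (\<^bold>\<forall>w. p)) \<^bold>\<longrightarrow> comprehension_axiom X x (\<^bold>\<exists>w. p))"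
    using RCA0 by (auto simp: models_def)
  have "M \<Turnstile> comprehension_axiom X x (\<^bold>\<exists>w. p)"
    using * w by (auto simp: true_in_def sat_fresh_nvar)
  from comprehension_instance[OF this _ assms(2), of e] X show ?thesis
    using w by (simp add: sat_fresh_nvar)
qed

text \<open>The form in which comprehension is applied below: the defining formula is written out,
  its set parameters are supplied by \<open>S\<close> and its number parameters by
  \<open>e\<close>.\<close>

lemma Sigma00_setI:
  assumes "Sigma00 p" "\<And>X. S X \<in> \<S>" "\<And>a. P a \<longleftrightarrow> sat M (e(x := a)) S p"
  shows "{a. P a} \<in> \<S>"
  using Sigma00_comprehension[OF assms(1,2), of e x] assms(3) by simp

lemma set_UNIV [simp]: "UNIV \<in> \<S>"
proof -
  obtain A where "A \<in> \<S>" using nonempty by (auto simp: l2_structure_def)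
  then have "{a :: 'a. True} \<in> \<S>"
    by (intro Sigma00_setI[where p = "\<^bold>0 \<^bold>= \<^bold>0" and S = "\<lambda>_. A"]) (auto intro: Sigma00.intros)
  then show ?thesis by simp
qed

lemma set_induct:
  assumes "A \<in> \<S>" "\<zero> \<in> A" "\<And>a. a \<in> A \<Longrightarrow> a \<oplus> \<one> \<in> A"
  shows "a \<in> A"
proof -
  \<comment> \<open>The vacuous quantifier only gives the formula the syntactic shape of the
    induction scheme.\<close>
  let ?p = "\<^bold>\<exists>''w''. NVar ''x'' \<^bold>\<in> ''X''"
  have "Sigma01 ?p" by (auto simp: Sigma01_def intro: Sigma00.intros)
  then have "induction_axiom ''x'' ?p \<in> RCA0" unfolding RCA0_def by blast
  then have "M \<Turnstile> induction_axiom ''x'' ?p" using RCA0 by (auto simp: models_def)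
  then have "sat M (\<lambda>_. \<zero>) (\<lambda>_. A) (induction_axiom ''x'' ?p)"
    using assms(1) by (auto simp: true_in_def)
  then show ?thesis using assms by (simp add: induction_axiom_def)
qed

lemma induct:
  assumes "{a. P a} \<in> \<S>" "P \<zero>" "\<And>a. P a \<Longrightarrow> P (a \<oplus> \<one>)"
  shows "P a"
  using set_induct[of "{a. P a}" a] assms by auto

section \<open>Ordered semiring laws from the basic axioms\<close>

lemma basic:
  shows succ_nonzero [simp]: "n \<oplus> \<one> \<noteq> \<zero>"
    and succ_inject [simp]: "m \<oplus> \<one> = n \<oplus> \<one> \<longleftrightarrow> m = n"
    and add_zero [simp]: "m \<oplus> \<zero> = m"
    and add_succ: "m \<oplus> (n \<oplus> \<one>) = (m \<oplus> n) \<oplus> \<one>"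
    and mult_zero [simp]: "m \<otimes> \<zero> = \<zero>"
    and mult_succ: "m \<otimes> (n \<oplus> \<one>) = (m \<otimes> n) \<oplus> m"
    and not_less_zero [simp]: "\<not> m \<prec> \<zero>"
    and less_succ: "m \<prec> n \<oplus> \<one> \<longleftrightarrow> m \<prec> n \<or> m = n"
proof -
  have "\<forall>p\<in>basic_axioms. sat M ((\<lambda>_. \<zero>)(''m'' := m, ''n'' := n)) (\<lambda>_. UNIV) p"
    using RCA0 by (auto simp: models_def RCA0_def true_in_def)
  note ax = this[unfolded basic_axioms_def Let_def, simplified]
  show "n \<oplus> \<one> \<noteq> \<zero>" "m \<oplus> \<one> = n \<oplus> \<one> \<longleftrightarrow> m = n" "m \<oplus> \<zero> = m"
    "m \<oplus> (n \<oplus> \<one>) = (m \<oplus> n) \<oplus> \<one>" "m \<otimes> \<zero> = \<zero>" "m \<otimes> (n \<oplus> \<one>) = (m \<otimes> n) \<oplus> m"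
    "\<not> m \<prec> \<zero>" "m \<prec> n \<oplus> \<one> \<longleftrightarrow> m \<prec> n \<or> m = n"
    using ax by auto
qed

lemma zero_add [simp]: "\<zero> \<oplus> a = a"
proof (induct a rule: induct)
  show "{a. \<zero> \<oplus> a = a} \<in> \<S>"
    by (rule Sigma00_setI[where p = "\<^bold>0 \<^bold>+ NVar ''x'' \<^bold>= NVar ''x''" and x = "''x''"
        and S = "\<lambda>_. UNIV"])
      (auto intro: Sigma00.intros)
qed (simp_all add: add_succ)

lemma succ_add: "(a \<oplus> \<one>) \<oplus> b = (a \<oplus> b) \<oplus> \<one>"
proof (induct b rule: induct)
  show "{b. (a \<oplus> \<one>) \<oplus> b = (a \<oplus> b) \<oplus> \<one>} \<in> \<S>"
    by (rule Sigma00_setI[where p = "(NVar ''a'' \<^bold>+ \<^bold>1) \<^bold>+ NVar ''b'' \<^bold>= (NVar ''a'' \<^bold>+ NVar ''b'') \<^bold>+ \<^bold>1"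
          and x = "''b''" and e = "\<lambda>_. a" and S = "\<lambda>_. UNIV"])
      (auto intro: Sigma00.intros)
  show "(a \<oplus> \<one>) \<oplus> (b \<oplus> \<one>) = (a \<oplus> (b \<oplus> \<one>)) \<oplus> \<one>"
    if "(a \<oplus> \<one>) \<oplus> b = (a \<oplus> b) \<oplus> \<one>" for b
    using that by (metis add_succ)
qed simp

lemma add_commute: "a \<oplus> b = b \<oplus> a"
proof (induct b rule: induct)
  show "{b. a \<oplus> b = b \<oplus> a} \<in> \<S>"
    by (rule Sigma00_setI[where p = "NVar ''a'' \<^bold>+ NVar ''b'' \<^bold>= NVar ''b'' \<^bold>+ NVar ''a''"
          and x = "''b''" and e = "\<lambda>_. a" and S = "\<lambda>_. UNIV"])
      (auto intro: Sigma00.intros)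
  show "a \<oplus> (b \<oplus> \<one>) = (b \<oplus> \<one>) \<oplus> a" if "a \<oplus> b = b \<oplus> a" for b
    using that by (metis add_succ succ_add)
qed simp

lemma add_assoc: "(a \<oplus> b) \<oplus> c = a \<oplus> (b \<oplus> c)"
proof (induct c rule: induct)
  show "{c. (a \<oplus> b) \<oplus> c = a \<oplus> (b \<oplus> c)} \<in> \<S>"
    by (rule Sigma00_setI[where p = "(NVar ''a'' \<^bold>+ NVar ''b'') \<^bold>+ NVar ''c'' \<^bold>= NVar ''a'' \<^bold>+ (NVar
        ''b'' \<^bold>+ NVar ''c'')"
          and x = "''c''" and e = "(\<lambda>_. a)(''b'' := b)" and S = "\<lambda>_. UNIV"])
      (auto intro: Sigma00.intros)
qed (simp_all add: add_succ)

lemma zero_mult [simp]: "\<zero> \<otimes> a = \<zero>"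
proof (induct a rule: induct)
  show "{a. \<zero> \<otimes> a = \<zero>} \<in> \<S>"
    by (rule Sigma00_setI[where p = "\<^bold>0 \<^bold>* NVar ''x'' \<^bold>= \<^bold>0" and x = "''x''" and S = "\<lambda>_. UNIV"])
      (auto intro: Sigma00.intros)
qed (simp_all add: mult_succ)

lemma succ_mult: "(a \<oplus> \<one>) \<otimes> b = (a \<otimes> b) \<oplus> b"
proof (induct b rule: induct)
  show "{b. (a \<oplus> \<one>) \<otimes> b = (a \<otimes> b) \<oplus> b} \<in> \<S>"
    by (rule Sigma00_setI[where p = "(NVar ''a'' \<^bold>+ \<^bold>1) \<^bold>* NVar ''b'' \<^bold>= (NVar ''a'' \<^bold>* NVar ''b'') \<^bold>+
        NVar ''b''"
          and x = "''b''" and e = "\<lambda>_. a" and S = "\<lambda>_. UNIV"])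
      (auto intro: Sigma00.intros)
  fix b assume "(a \<oplus> \<one>) \<otimes> b = (a \<otimes> b) \<oplus> b"
  then show "(a \<oplus> \<one>) \<otimes> (b \<oplus> \<one>) = (a \<otimes> (b \<oplus> \<one>)) \<oplus> (b \<oplus> \<one>)"
    by (metis mult_succ add_assoc add_commute)
qed simp

lemma mult_commute: "a \<otimes> b = b \<otimes> a"
proof (induct b rule: induct)
  show "{b. a \<otimes> b = b \<otimes> a} \<in> \<S>"
    by (rule Sigma00_setI[where p = "NVar ''a'' \<^bold>* NVar ''b'' \<^bold>= NVar ''b'' \<^bold>* NVar ''a''"
          and x = "''b''" and e = "\<lambda>_. a" and S = "\<lambda>_. UNIV"])
      (auto intro: Sigma00.intros)
qed (simp_all add: mult_succ succ_mult)

lemma add_mult: "(a \<oplus> b) \<otimes> c = a \<otimes> c \<oplus> b \<otimes> c"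
proof (induct c rule: induct)
  show "{c. (a \<oplus> b) \<otimes> c = a \<otimes> c \<oplus> b \<otimes> c} \<in> \<S>"
    by (rule Sigma00_setI[where p = "(NVar ''a'' \<^bold>+ NVar ''b'') \<^bold>* NVar ''c'' \<^bold>= NVar ''a'' \<^bold>* NVar
        ''c'' \<^bold>+ NVar ''b'' \<^bold>* NVar ''c''"
          and x = "''c''" and e = "(\<lambda>_. a)(''b'' := b)" and S = "\<lambda>_. UNIV"])
      (auto intro: Sigma00.intros)
  fix c assume "(a \<oplus> b) \<otimes> c = a \<otimes> c \<oplus> b \<otimes> c"
  then show "(a \<oplus> b) \<otimes> (c \<oplus> \<one>) = a \<otimes> (c \<oplus> \<one>) \<oplus> b \<otimes> (c \<oplus> \<one>)"
    by (simp add: mult_succ) (metis add_assoc add_commute)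
qed simp

lemma mult_assoc: "(a \<otimes> b) \<otimes> c = a \<otimes> (b \<otimes> c)"
proof (induct c rule: induct)
  show "{c. (a \<otimes> b) \<otimes> c = a \<otimes> (b \<otimes> c)} \<in> \<S>"
    by (rule Sigma00_setI[where p = "(NVar ''a'' \<^bold>* NVar ''b'') \<^bold>* NVar ''c'' \<^bold>= NVar ''a'' \<^bold>* (NVar
        ''b'' \<^bold>* NVar ''c'')"
          and x = "''c''" and e = "(\<lambda>_. a)(''b'' := b)" and S = "\<lambda>_. UNIV"])
      (auto intro: Sigma00.intros)
  fix c assume "(a \<otimes> b) \<otimes> c = a \<otimes> (b \<otimes> c)"
  then show "(a \<otimes> b) \<otimes> (c \<oplus> \<one>) = a \<otimes> (b \<otimes> (c \<oplus> \<one>))"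
    by (simp add: mult_succ) (metis add_mult mult_commute)
qed simp

lemma one_mult: "\<one> \<otimes> a = a"
  using succ_mult[of \<zero> a] by simp

lemma add_right_cancel: "a \<oplus> c = b \<oplus> c \<longleftrightarrow> a = b"
proof -
  have "a \<oplus> c = b \<oplus> c \<longrightarrow> a = b"
  proof (induct c rule: induct)
    show "{c. a \<oplus> c = b \<oplus> c \<longrightarrow> a = b} \<in> \<S>"
      by (rule Sigma00_setI[where p = "NVar ''a'' \<^bold>+ NVar ''c'' \<^bold>= NVar ''b'' \<^bold>+ NVar ''c'' \<^bold>\<longrightarrow>
          NVar ''a'' \<^bold>= NVar ''b''"
            and x = "''c''" and e = "(\<lambda>_. a)(''b'' := b)" and S = "\<lambda>_. UNIV"])
        (auto intro: Sigma00.intros)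
  qed (simp_all add: add_succ)
  then show ?thesis by auto
qed

lemma add_left_cancel: "c \<oplus> a = c \<oplus> b \<longleftrightarrow> a = b"
  using add_right_cancel by (simp add: add_commute[of c])

lemma zero_or_succ: "a = \<zero> \<or> (\<exists>b. a = b \<oplus> \<one>)"
proof -
  \<comment> \<open>Bounding the predecessor makes the induction formula Sigma00.\<close>
  have "a = \<zero> \<or> (\<exists>b. b \<prec> a \<and> a = b \<oplus> \<one>)"
  proof (induct a rule: induct)
    show "{a. a = \<zero> \<or> (\<exists>b. b \<prec> a \<and> a = b \<oplus> \<one>)} \<in> \<S>"
      by (rule Sigma00_setI[where p = "NVar ''a'' \<^bold>= \<^bold>0 \<^bold>\<or> (\<^bold>\<exists>''b''. NVar ''b'' \<^bold>< NVar ''a'' \<^bold>\<and>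
          NVar ''a'' \<^bold>= NVar ''b'' \<^bold>+ \<^bold>1)"
            and x = "''a''" and S = "\<lambda>_. UNIV"])
        (auto intro!: Sigma00.intros)
  qed (auto simp: less_succ)
  then show ?thesis by auto
qed

lemma less_add_succ: "a \<prec> a \<oplus> (c \<oplus> \<one>)"
proof (induct c rule: induct)
  show "{c. a \<prec> a \<oplus> (c \<oplus> \<one>)} \<in> \<S>"
    by (rule Sigma00_setI[where p = "NVar ''a'' \<^bold>< NVar ''a'' \<^bold>+ (NVar ''c'' \<^bold>+ \<^bold>1)"
          and x = "''c''" and e = "(\<lambda>_. a)" and S = "\<lambda>_. UNIV"])
      (auto intro: Sigma00.intros)
  show "a \<prec> a \<oplus> (c \<oplus> \<one> \<oplus> \<one>)" if "a \<prec> a \<oplus> (c \<oplus> \<one>)" for c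
    using that by (simp add: add_succ[of a "c \<oplus> \<one>"] less_succ)
qed (simp add: less_succ)

lemma less_iff: "a \<prec> b \<longleftrightarrow> (\<exists>c. b = a \<oplus> (c \<oplus> \<one>))"
proof -
  \<comment> \<open>As with the predecessor, the bound on \<open>c\<close> keeps the induction
    formula Sigma00.\<close>
  have "a \<prec> b \<longrightarrow> (\<exists>c. c \<prec> b \<and> b = a \<oplus> (c \<oplus> \<one>))"
  proof (induct b rule: induct)
    show "{b. a \<prec> b \<longrightarrow> (\<exists>c. c \<prec> b \<and> b = a \<oplus> (c \<oplus> \<one>))} \<in> \<S>"
      by (rule Sigma00_setI[where p = "NVar ''a'' \<^bold>< NVar ''b'' \<^bold>\<longrightarrow> (\<^bold>\<exists>''c''. NVar ''c'' \<^bold>< NVar ''b'' \<^bold>\<and>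
          NVar ''b'' \<^bold>= NVar ''a'' \<^bold>+ (NVar ''c'' \<^bold>+ \<^bold>1))"
            and x = "''b''" and e = "(\<lambda>_. a)" and S = "\<lambda>_. UNIV"])
        (auto intro!: Sigma00.intros)
    fix b assume IH: "a \<prec> b \<longrightarrow> (\<exists>c. c \<prec> b \<and> b = a \<oplus> (c \<oplus> \<one>))"
    show "a \<prec> b \<oplus> \<one> \<longrightarrow> (\<exists>c. c \<prec> b \<oplus> \<one> \<and> b \<oplus> \<one> = a \<oplus> (c \<oplus> \<one>))"
    proof
      assume "a \<prec> b \<oplus> \<one>"
      then consider "a \<prec> b" | "a = b" by (auto simp: less_succ)
      then show "\<exists>c. c \<prec> b \<oplus> \<one> \<and> b \<oplus> \<one> = a \<oplus> (c \<oplus> \<one>)"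
      proof cases
        case 1
        then obtain c where c: "b = a \<oplus> (c \<oplus> \<one>)" using IH by auto
        then have "b \<oplus> \<one> = a \<oplus> ((c \<oplus> \<one>) \<oplus> \<one>)" by (simp add: add_succ)
        moreover from c have "b = (c \<oplus> \<one>) \<oplus> a" by (simp add: add_commute)
        then have "c \<oplus> \<one> \<prec> b \<oplus> \<one>"
          using less_add_succ[of "c \<oplus> \<one>" a] by (simp add: add_succ)
        ultimately show ?thesis by blast
      next
        case 2
        then show ?thesis
          using less_add_succ[of \<zero> b] by (intro exI[of _ \<zero>]) simp
      qed
    qed
  qed simp
  then show ?thesis using less_add_succ by auto
qed

lemma less_trans: "a \<prec> b \<Longrightarrow> b \<prec> c \<Longrightarrow> a \<prec> c"
  by (auto simp: less_iff) (metis add_assoc add_succ)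

lemma less_irrefl: "\<not> a \<prec> a"
proof
  assume "a \<prec> a"
  then obtain c where "a = a \<oplus> (c \<oplus> \<one>)" by (auto simp: less_iff)
  then have "\<zero> \<oplus> a = (c \<oplus> \<one>) \<oplus> a" by (metis add_commute zero_add)
  then show False unfolding add_right_cancel by (metis succ_nonzero)
qed

lemma zero_less_succ [simp]: "\<zero> \<prec> a \<oplus> \<one>"
  using less_add_succ[of \<zero> a] by simp

lemma less_linear: "a \<prec> b \<or> a = b \<or> b \<prec> a"
proof (induct b rule: induct)
  show "{b. a \<prec> b \<or> a = b \<or> b \<prec> a} \<in> \<S>"
    by (rule Sigma00_setI[where p = "NVar ''a'' \<^bold>< NVar ''b'' \<^bold>\<or> NVar ''a'' \<^bold>= NVar ''b'' \<^bold>\<or> NVar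
        ''b'' \<^bold>< NVar ''a''"
          and x = "''b''" and e = "(\<lambda>_. a)" and S = "\<lambda>_. UNIV"])
      (auto intro!: Sigma00.intros)
  show "a \<prec> \<zero> \<or> a = \<zero> \<or> \<zero> \<prec> a"
    using zero_or_succ[of a] by auto
  fix b assume "a \<prec> b \<or> a = b \<or> b \<prec> a"
  then consider "a \<prec> b \<or> a = b" | c where "a = b \<oplus> (c \<oplus> \<one>)" by (auto simp: less_iff)
  then show "a \<prec> b \<oplus> \<one> \<or> a = b \<oplus> \<one> \<or> b \<oplus> \<one> \<prec> a"
  proof cases
    case 2
    from zero_or_succ[of c] show ?thesis
    proof
      assume "\<exists>d. c = d \<oplus> \<one>"
      then obtain d where "a = (b \<oplus> \<one>) \<oplus> (d \<oplus> \<one>)"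
        using 2 by (metis add_succ succ_add)
      then show ?thesis by (simp add: less_add_succ)
    qed (use 2 in simp)
  qed (auto simp: less_succ)
qed

definition le (infix \<open>\<preceq>\<close> 50) where "a \<preceq> b \<longleftrightarrow> a \<prec> b \<or> a = b"

lemma less_succ_le: "a \<prec> b \<oplus> \<one> \<longleftrightarrow> a \<preceq> b"
  by (simp add: le_def less_succ)

lemma le_iff: "a \<preceq> b \<longleftrightarrow> (\<exists>c. b = a \<oplus> c)"
  unfolding less_succ_le[symmetric] unfolding less_iff by (simp add: add_succ)

definition diff where "diff a b = (if b \<preceq> a then THE c. a = b \<oplus> c else \<zero>)"

lemma diff_add [simp]: "diff (b \<oplus> c) b = c"
proof -
  have "b \<preceq> b \<oplus> c" by (auto simp: le_iff)
  then show ?thesis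
    by (auto simp: diff_def add_left_cancel)
qed

sublocale ord: linorder "(\<preceq>)" "(\<prec>)"
  by unfold_locales (unfold le_def; use less_trans less_irrefl less_linear in blast)+

text \<open>Makes the library's order and divisibility lemmas available for the elements of the
  model; truncated subtraction is there because the locale has it as a parameter.\<close>

sublocale mn: linordered_semidom "(\<oplus>)" diff "(\<preceq>)" "(\<prec>)" \<zero> "(\<otimes>)" \<one>
proof
  fix a b c
  show "a \<oplus> b \<oplus> c = a \<oplus> (b \<oplus> c)" by (rule add_assoc)
  show "a \<oplus> b = b \<oplus> a" by (rule add_commute)
  show "diff (a \<oplus> b) a = b" by simp
  show "diff (diff a b) c = diff a (b \<oplus> c)"
  proof (cases "b \<preceq> a")
    case True
    then obtain x where x: "a = b \<oplus> x" by (auto simp: le_iff)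
    show ?thesis
    proof (cases "c \<preceq> x")
      case True
      then obtain y where "x = c \<oplus> y" by (auto simp: le_iff)
      with x have "diff (diff a b) c = y" and "a = (b \<oplus> c) \<oplus> y" by (simp_all add: add_assoc)
      then show ?thesis by simp
    next
      case False
      then have "\<not> b \<oplus> c \<preceq> a"
        using x by (auto simp: le_iff add_assoc add_left_cancel)
      with False x show ?thesis by (simp add: diff_def[of _ c] diff_def[of _ "b \<oplus> c"])
    qed
  next
    case False
    moreover from False have "\<not> b \<oplus> c \<preceq> a" by (auto simp: le_iff add_assoc)
    moreover have "diff \<zero> c = \<zero>"
    proof (cases "c \<preceq> \<zero>")
      case True
      then have "c = \<zero>" by (simp add: le_def)
      then show ?thesis using diff_add[of \<zero> \<zero>] by simp
    qed (simp add: diff_def)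
    ultimately show ?thesis by (simp add: diff_def)
  qed
  show "\<zero> \<oplus> a = a" by simp
  show "\<zero> \<otimes> a = \<zero>" "a \<otimes> \<zero> = \<zero>" by simp_all
  show "a \<otimes> b \<otimes> c = a \<otimes> (b \<otimes> c)" by (rule mult_assoc)
  show "a \<otimes> b = b \<otimes> a" by (rule mult_commute)
  show "\<one> \<otimes> a = a" by (rule one_mult)
  show "(a \<oplus> b) \<otimes> c = a \<otimes> c \<oplus> b \<otimes> c" by (rule add_mult)
  show "a \<otimes> (b \<oplus> c) = a \<otimes> b \<oplus> a \<otimes> c" by (simp add: mult_commute[of a] add_mult)
  show "\<zero> \<noteq> \<one>" using succ_nonzero[of \<zero>] by simp
  show "\<zero> \<prec> \<one>" using zero_less_succ[of \<zero>] by simp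
  show strict: "c \<otimes> a \<prec> c \<otimes> b" if "a \<prec> b" "\<zero> \<prec> c" for a b c
  proof -
    from that obtain x y where b: "b = a \<oplus> (x \<oplus> \<one>)" and c: "c = y \<oplus> \<one>"
      by (auto simp: less_iff)
    have "c \<otimes> b = c \<otimes> a \<oplus> (c \<otimes> x \<oplus> c)"
      unfolding b by (metis add_mult mult_commute mult_succ)
    also have "c \<otimes> x \<oplus> c = (c \<otimes> x \<oplus> y) \<oplus> \<one>"
      unfolding c add_succ ..
    finally show ?thesis by (simp add: less_add_succ)
  qed
  show "c \<oplus> a \<preceq> c \<oplus> b" if "a \<preceq> b" using that by (auto simp: le_iff add_assoc)
  show "diff a b \<oplus> b = a" if "b \<preceq> a" using that by (metis le_iff diff_add add_commute)
  show "a \<otimes> b \<noteq> \<zero>" if "a \<noteq> \<zero>" "b \<noteq> \<zero>"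
    using strict[of \<zero> b a] that zero_or_succ[of a] zero_or_succ[of b] by auto
  show "a \<otimes> diff b c = diff (a \<otimes> b) (a \<otimes> c)"
  proof (cases "c \<preceq> b")
    case True
    then obtain x where "b = c \<oplus> x" by (auto simp: le_iff)
    then show ?thesis by (simp add: mult_commute[of a] add_mult)
  next
    case False
    then have "b \<prec> c" using less_linear by (auto simp: le_def)
    show ?thesis
    proof (cases "a = \<zero>")
      case True
      then show ?thesis using diff_add[of \<zero> \<zero>] by simp
    next
      case a: False
      then have "\<zero> \<prec> a" using zero_or_succ[of a] by auto
      from strict[OF \<open>b \<prec> c\<close> this] have "\<not> a \<otimes> c \<preceq> a \<otimes> b"
        by (simp add: ord.not_le)
      with False show ?thesis by (simp add: diff_def)
    qed
  qed
qed

lemma zero_le [simp]: "\<zero> \<preceq> a"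
  using zero_or_succ[of a] by (auto simp: le_def)

lemma succ_le_iff: "a \<oplus> \<one> \<preceq> b \<longleftrightarrow> a \<prec> b"
  by (metis less_succ_le mn.add_less_cancel_right)

section \<open>Pairing, standard numerals and least elements\<close>

definition pr where "pr a b = (a \<oplus> b) \<otimes> (a \<oplus> b) \<oplus> a"

lemma tm_val_pair [simp]: "tm_val M e \<^bold>\<langle>s, t\<^bold>\<rangle> = pr (tm_val M e s) (tm_val M e t)"
  by (simp add: pair_tm_def pr_def)

text \<open>All pairs with sum \<open>u\<close> lie between \<open>u^2\<close> and
  \<open>u^2 + u\<close>, which is below \<open>(u + 1)^2\<close>; so the blocks belonging to
  different sums are disjoint and ordered.\<close>

lemma pr_less_mono:
  assumes "a \<oplus> b \<prec> c \<oplus> d"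
  shows "pr a b \<prec> pr c d"
proof -
  let ?u = "a \<oplus> b" and ?v = "c \<oplus> d"
  have "?u \<oplus> \<one> \<preceq> ?v" using assms by (simp add: succ_le_iff)
  then have "(?u \<oplus> \<one>) \<otimes> (?u \<oplus> \<one>) \<preceq> ?v \<otimes> ?v" by (intro mn.mult_mono) auto
  moreover have "?u \<otimes> ?u \<oplus> ?u \<prec> (?u \<oplus> \<one>) \<otimes> (?u \<oplus> \<one>)"
    by (simp add: mult_succ succ_mult less_succ_le mn.add_increasing2 flip: add_assoc)
  moreover have "pr a b \<preceq> ?u \<otimes> ?u \<oplus> ?u" by (auto simp: pr_def mn.add_left_mono mn.add_increasing2)
  moreover have "?v \<otimes> ?v \<preceq> pr c d" by (simp add: pr_def mn.add_increasing2)
  ultimately show ?thesis by order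
qed

lemma pr_inject [simp]: "pr a b = pr c d \<longleftrightarrow> a = c \<and> b = d"
proof
  assume *: "pr a b = pr c d"
  have "a \<oplus> b = c \<oplus> d"
    using pr_less_mono[of a b c d] pr_less_mono[of c d a b] less_linear * less_irrefl by metis
  with * show "a = c \<and> b = d"
    by (auto simp: pr_def)
qed simp

lemma pr_less: "v \<prec> m \<Longrightarrow> j \<prec> n \<Longrightarrow> pr v j \<prec> pr m n"
  by (intro pr_less_mono mn.add_strict_mono)

lemma le_square: "a \<preceq> a \<otimes> a"
  using zero_or_succ[of a] by (auto simp: mult_succ mn.add_increasing)

lemma sum_le_pr: "a \<oplus> b \<preceq> pr a b"
  using le_square[of "a \<oplus> b"] by (auto simp: pr_def intro: mn.add_increasing2)

lemma fst_le_pr [simp]: "a \<preceq> pr a b" and snd_le_pr [simp]: "b \<preceq> pr a b"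
  using sum_le_pr[of a b] ord.order_trans by (force simp: le_iff add_commute)+

fun num :: "nat \<Rightarrow> 'a" where
  "num 0 = \<zero>"
| "num (Suc n) = num n \<oplus> \<one>"

lemma tm_val_numeral [simp]: "tm_val M e (numeral_tm n) = num n"
  by (induction n) auto

text \<open>A standard number has only standard numbers below it. The set of \<open>k\<close> colors
  is therefore finite in the sense of HOL as well.\<close>

lemma less_num_iff: "a \<prec> num k \<longleftrightarrow> (\<exists>j<k. a = num j)"
  by (induction k) (auto simp: less_succ less_Suc_eq)

lemma num_inject [simp]: "num i = num j \<longleftrightarrow> i = j"
proof (induction i arbitrary: j)
  case 0
  then show ?case using succ_nonzero by (cases j) (auto dest: sym)
next
  case (Suc i)
  then show ?case by (cases j) auto
qed

lemma set_least:
  assumes "A \<in> \<S>" "a \<in> A"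
  obtains m where "m \<in> A" "\<And>x. x \<prec> m \<Longrightarrow> x \<notin> A"
proof -
  have "\<exists>m. m \<in> A \<and> (\<forall>x. x \<prec> m \<longrightarrow> x \<notin> A)"
  proof (rule ccontr)
    assume no: "\<not> ?thesis"
    have "\<forall>x. x \<prec> a \<longrightarrow> x \<notin> A" for a
    proof (induct a rule: induct)
      show "{a. \<forall>x. x \<prec> a \<longrightarrow> x \<notin> A} \<in> \<S>"
        by (rule Sigma00_setI[where p = "\<^bold>\<forall>''x''. NVar ''x'' \<^bold>< NVar ''a'' \<^bold>\<longrightarrow> \<^bold>\<not> NVar ''x'' \<^bold>\<in> ''A''"
              and x = "''a''" and S = "\<lambda>_. A"])
          (auto intro!: Sigma00.intros assms)
      show "\<forall>x. x \<prec> a \<oplus> \<one> \<longrightarrow> x \<notin> A" if "\<forall>x. x \<prec> a \<longrightarrow> x \<notin> A" for a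
        using no that by (metis less_succ)
    qed simp
    from this[of "a \<oplus> \<one>"] assms show False by (metis less_succ)
  qed
  then show ?thesis using that by blast
qed

section \<open>Arithmetical comprehension from \<open>\<Sigma>\<^sup>0\<^sub>1\<close> comprehension\<close>

text \<open>Closure under projection of a single binary relation; packing parameters into tuples
  turns it into comprehension for all Sigma01 formulas.\<close>

definition Sigma01_closed where
  "Sigma01_closed \<longleftrightarrow> (\<forall>A\<in>\<S>. {a. \<exists>b. pr a b \<in> A} \<in> \<S>)"

definition ACA where
  "ACA \<longleftrightarrow> (\<forall>p S e x. arithmetical p \<longrightarrow> (\<forall>X. S X \<in> \<S>) \<longrightarrow> {a. sat M (e(x := a)) S p} \<in> \<S>)"

lemma tuple_inject:
  "tm_val M e (tuple_tm xs) = tm_val M e' (tuple_tm xs) \<longleftrightarrow> (\<forall>x\<in>set xs. e x = e' x)"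
  by (induction xs) auto

lemma le_tuple: "x \<in> set xs \<Longrightarrow> e x \<preceq> tm_val M e (tuple_tm xs)"
  by (induction xs) (auto intro: ord.order_trans)

lemma sat_bex:
  assumes "z \<notin> set xs"
  shows "sat M e S (bex_fm z xs p) \<longleftrightarrow>
    (\<exists>e'. (\<forall>x. x \<notin> set xs \<longrightarrow> e' x = e x) \<and> (\<forall>x\<in>set xs. e' x \<preceq> e z) \<and> sat M e' S p)"
  using assms
proof (induction xs arbitrary: e)
  case Nil
  then show ?case by (auto simp flip: fun_eq_iff)
next
  case (Cons y xs)
  have "sat M e S (bex_fm z (y # xs) p) \<longleftrightarrow> (\<exists>a. a \<preceq> e z \<and> sat M (e(y := a)) S (bex_fm z xs p))"
    using Cons.prems by (auto simp: less_succ_le)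
  also have "\<dots> \<longleftrightarrow> (\<exists>a. a \<preceq> e z \<and> (\<exists>e'. (\<forall>x. x \<notin> set xs \<longrightarrow> e' x = (e(y := a)) x) \<and>
      (\<forall>x\<in>set xs. e' x \<preceq> e z) \<and> sat M e' S p))"
    using Cons.prems by (simp add: Cons.IH)
  also have "\<dots> \<longleftrightarrow> (\<exists>e'. (\<forall>x. x \<notin> set (y # xs) \<longrightarrow> e' x = e x) \<and> (\<forall>x\<in>set (y # xs). e' x \<preceq> e z) \<and>
      sat M e' S p)"
    (is "?L \<longleftrightarrow> ?R")
  proof
    assume ?L
    then show ?R by (metis fun_upd_apply insert_iff list.simps(15))
  next
    assume ?R
    then obtain e' where "\<forall>x. x \<notin> set (y # xs) \<longrightarrow> e' x = e x" "\<forall>x\<in>set (y # xs). e' x \<preceq> e z" "sat M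
        e' S p"
      by blast
    then show ?L
      by (intro exI[of _ "e' y"] conjI exI[of _ e']) auto
  qed
  finally show ?case .
qed

text \<open>With \<open>\<Sigma>\<^sup>0\<^sub>1\<close> comprehension, a formula with one unbounded quantifier becomes a membership
  statement about the tuple of its parameters. This is what allows quantifiers to be eliminated
  one after the other.\<close>

lemma Sigma01_as_membership:
  assumes closed: Sigma01_closed and p: "Sigma00 p" and S: "\<And>X. S X \<in> \<S>"
  shows "\<exists>t. \<exists>A\<in>\<S>. \<forall>e. sat M e S (\<^bold>\<exists>w. p) \<longleftrightarrow> tm_val M e t \<in> A"
proof -
  obtain xs where xs: "set xs = nvars p - {w}"
    using finite_list[of "nvars p - {w}"] by auto
  obtain z where z: "z \<notin> insert w (nvars p)"
    using fresh_string[of "insert w (nvars p)"] by auto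
  obtain y where y: "y \<notin> insert z (insert w (nvars p))"
    using fresh_string[of "insert z (insert w (nvars p))"] by auto
  \<comment> \<open>\<open>?q\<close> decodes \<open>z\<close> into values of the parameters and
    evaluates \<open>p\<close>; \<open>?q'\<close> says that \<open>y\<close> pairs such a code with
    a witness. Projecting the set defined by \<open>?q'\<close> removes the witness.\<close>
  let ?q = "bex_fm z xs (NVar z \<^bold>= tuple_tm xs \<^bold>\<and> p)"
  let ?q' = "\<^bold>\<exists>z. NVar z \<^bold>< NVar y \<^bold>+ \<^bold>1 \<^bold>\<and> (\<^bold>\<exists>w. NVar w \<^bold>< NVar y \<^bold>+ \<^bold>1 \<^bold>\<and> NVar y \<^bold>= \<^bold>\<langle>NVar z, NVar w\<^bold>\<rangle> \<^bold>\<and> ?q)"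
  have zxs: "z \<notin> set xs" and wxs: "w \<notin> set xs" and yxs: "y \<notin> set xs"
      and d: "y \<noteq> z" "w \<noteq> y" "w \<noteq> z" "z \<noteq> y"
    using xs z y by auto
  have q: "sat M e S ?q \<longleftrightarrow> (\<exists>e'. (\<forall>x. x \<notin> set xs \<longrightarrow> e' x = e x) \<and> e z = tm_val M e' (tuple_tm xs) \<and>
      sat M e' S p)"
    (is "_ \<longleftrightarrow> ?R") for e
  proof
    show "sat M e S ?q \<Longrightarrow> ?R"
      unfolding sat_bex[OF zxs] using zxs by auto
    assume ?R
    then obtain e' where "\<forall>x. x \<notin> set xs \<longrightarrow> e' x = e x" "e z = tm_val M e' (tuple_tm xs)" "sat M e'
        S p"
      by blast
    then show "sat M e S ?q"
      unfolding sat_bex[OF zxs] using zxs le_tuple[of _ xs e'] by (intro exI[of _ e']) auto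
  qed
  have "Sigma00 ?q'"
    using z y p d zxs by (auto intro!: Sigma00.intros Sigma00_bex)
  then have "{c. sat M ((\<lambda>_. \<zero>)(y := c)) S ?q'} \<in> \<S>"
    using S by (rule Sigma00_comprehension)
  moreover have "sat M (((\<lambda>_. \<zero>)(y := c))) S ?q' \<longleftrightarrow>
      (\<exists>a b. c = pr a b \<and> sat M ((\<lambda>_. \<zero>)(y := c, z := a, w := b)) S ?q)" for c
    using d by (simp only: sat.simps) (auto simp: less_succ_le)
  ultimately have "{c. \<exists>a b. c = pr a b \<and> sat M ((\<lambda>_. \<zero>)(y := c, z := a, w := b)) S ?q} \<in> \<S>"
    by simp
  with closed have "{a. \<exists>b. pr a b \<in> {c. \<exists>a b. c = pr a b \<and>
      sat M ((\<lambda>_. \<zero>)(y := c, z := a, w := b)) S ?q}} \<in> \<S>"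
    unfolding Sigma01_closed_def by blast
  then have A: "{a. \<exists>b. sat M ((\<lambda>_. \<zero>)(y := pr a b, z := a, w := b)) S ?q} \<in> \<S>" (is "?A \<in> _")
    by simp
  have "sat M e S (\<^bold>\<exists>w. p) \<longleftrightarrow> tm_val M e (tuple_tm xs) \<in> ?A" for e
  proof
    assume "sat M e S (\<^bold>\<exists>w. p)"
    then obtain b where b: "sat M (e(w := b)) S p" by auto
    let ?a = "tm_val M e (tuple_tm xs)"
    let ?e = "\<lambda>x. if x \<in> set xs then e x else ((\<lambda>_. \<zero>)(y := pr ?a b, z := ?a, w := b)) x"
    have "sat M ?e S p"
      by (rule sat_cong[THEN iffD1, OF _ _ b]) (use xs wxs in auto)
    moreover have "tm_val M ?e (tuple_tm xs) = ?a"
      by (rule tm_val_cong) auto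
    ultimately have "sat M ((\<lambda>_. \<zero>)(y := pr ?a b, z := ?a, w := b)) S ?q"
      unfolding q using d by (intro exI[of _ ?e]) auto
    then show "?a \<in> ?A" by blast
  next
    assume "tm_val M e (tuple_tm xs) \<in> ?A"
    then obtain b e' where e': "e' w = b" "tm_val M e (tuple_tm xs) = tm_val M e' (tuple_tm xs)"
      "sat M e' S p"
      unfolding q using d wxs by auto
    have "sat M (e(w := b)) S p"
      by (rule sat_cong[THEN iffD1, OF _ _ e'(3)])
          (use xs wxs e'(1) e'(2)[unfolded tuple_inject] in auto)
    then show "sat M e S (\<^bold>\<exists>w. p)" by auto
  qed
  with A show ?thesis by blast
qed

lemma Sigma00_as_membership:
  assumes Sigma01_closed "Sigma00 p" "\<And>X. S X \<in> \<S>"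
  shows "\<exists>t. \<exists>A\<in>\<S>. \<forall>e. sat M e S p \<longleftrightarrow> tm_val M e t \<in> A"
proof -
  obtain w where w: "w \<notin> nvars p"
    using fresh_string[of "nvars p"] by auto
  then show ?thesis
    using Sigma01_as_membership[OF assms, where w = w] by (simp add: sat_fresh_nvar)
qed

lemma boolean_as_membership:
  assumes Sigma01_closed "A \<in> \<S>" "B \<in> \<S>" "Sigma00 p"
  shows "\<exists>t. \<exists>C\<in>\<S>. \<forall>e. sat M e ((\<lambda>_. A)(''B'' := B)) p \<longleftrightarrow> tm_val M e t \<in> C"
  by (rule Sigma00_as_membership) (use assms in auto)

text \<open>The term and the set do not depend on \<open>e\<close>. This uniformity is what lets the
  quantifier cases vary \<open>e\<close> under the induction hypothesis, which has replaced the
  subformula by an atom.\<close>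

lemma arithmetical_as_membership:
  assumes closed: Sigma01_closed and S: "\<And>X. S X \<in> \<S>"
  shows "arithmetical p \<Longrightarrow> \<exists>t. \<exists>A\<in>\<S>. \<forall>e. sat M e S p \<longleftrightarrow> tm_val M e t \<in> A"
proof (induction p)
  case (Neg p)
  then obtain t A where A: "A \<in> \<S>" "\<And>e. sat M e S p \<longleftrightarrow> tm_val M e t \<in> A" by auto
  show ?case
    using Sigma00_as_membership[OF closed, of "\<^bold>\<not> t \<^bold>\<in> ''A''" "\<lambda>_. A"] A
    by (auto intro!: Sigma00.intros)
next
  case (Conj p q)
  then obtain t A s B where A: "A \<in> \<S>" "\<And>e. sat M e S p \<longleftrightarrow> tm_val M e t \<in> A"
    "B \<in> \<S>" "\<And>e. sat M e S q \<longleftrightarrow> tm_val M e s \<in> B" by auto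
  show ?case
    using boolean_as_membership[OF closed A(1,3), of "t \<^bold>\<in> ''A'' \<^bold>\<and> s \<^bold>\<in> ''B''"] A(2,4)
    by (simp add: Sigma00.intros)
next
  case (Disj p q)
  then obtain t A s B where A: "A \<in> \<S>" "\<And>e. sat M e S p \<longleftrightarrow> tm_val M e t \<in> A"
    "B \<in> \<S>" "\<And>e. sat M e S q \<longleftrightarrow> tm_val M e s \<in> B" by auto
  show ?case
    using boolean_as_membership[OF closed A(1,3), of "t \<^bold>\<in> ''A'' \<^bold>\<or> s \<^bold>\<in> ''B''"] A(2,4)
    by (simp add: Sigma00.intros)
next
  case (Imp p q)
  then obtain t A s B where A: "A \<in> \<S>" "\<And>e. sat M e S p \<longleftrightarrow> tm_val M e t \<in> A"
    "B \<in> \<S>" "\<And>e. sat M e S q \<longleftrightarrow> tm_val M e s \<in> B" by auto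
  show ?case
    using boolean_as_membership[OF closed A(1,3), of "t \<^bold>\<in> ''A'' \<^bold>\<longrightarrow> s \<^bold>\<in> ''B''"] A(2,4)
    by (simp add: Sigma00.intros)
next
  case (Iff p q)
  then obtain t A s B where A: "A \<in> \<S>" "\<And>e. sat M e S p \<longleftrightarrow> tm_val M e t \<in> A"
    "B \<in> \<S>" "\<And>e. sat M e S q \<longleftrightarrow> tm_val M e s \<in> B" by auto
  show ?case
    using boolean_as_membership[OF closed A(1,3), of "t \<^bold>\<in> ''A'' \<^bold>\<longleftrightarrow> s \<^bold>\<in> ''B''"] A(2,4)
    by (simp add: Sigma00.intros)
next
  case (ExN x p)
  then obtain t A where A: "A \<in> \<S>" "\<And>e. sat M e S p \<longleftrightarrow> tm_val M e t \<in> A" by auto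
  show ?case
    using Sigma01_as_membership[OF closed, of "t \<^bold>\<in> ''A''" "\<lambda>_. A" x] A
    by (auto intro!: Sigma00.intros)
next
  case (AllN x p)
  then obtain t A where A: "A \<in> \<S>" "\<And>e. sat M e S p \<longleftrightarrow> tm_val M e t \<in> A" by auto
  \<comment> \<open>A universal quantifier is handled as the complement of a projection of the
    complement.\<close>
  obtain s B where B: "B \<in> \<S>" "\<And>e. (\<exists>a. tm_val M (e(x := a)) t \<notin> A) \<longleftrightarrow> tm_val M e s \<in> B"
    using Sigma01_as_membership[OF closed, of "\<^bold>\<not> t \<^bold>\<in> ''A''" "\<lambda>_. A" x] A
    by (auto intro!: Sigma00.intros)
  have "sat M e S (\<^bold>\<forall>x. p) \<longleftrightarrow> tm_val M e s \<notin> B" for e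
    using A(2) B(2)[of e] by auto
  then show ?case
    using Sigma00_as_membership[OF closed, of "\<^bold>\<not> s \<^bold>\<in> ''B''" "\<lambda>_. B"] B(1)
    by (auto intro!: Sigma00.intros)
qed (auto intro!: Sigma00_as_membership closed S Sigma00.intros simp del: sat.simps)

lemma ACA_if_Sigma01_closed:
  assumes Sigma01_closed
  shows ACA
  unfolding ACA_def
proof (intro allI impI)
  fix p e x and S :: "string \<Rightarrow> 'a set" assume "arithmetical p" and S: "\<forall>X. S X \<in> \<S>"
  then obtain t A where A: "A \<in> \<S>" "\<And>e. sat M e S p \<longleftrightarrow> tm_val M e t \<in> A"
    using arithmetical_as_membership[OF assms] by blast
  show "{a. sat M (e(x := a)) S p} \<in> \<S>"
    by (rule Sigma00_setI[where p = "t \<^bold>\<in> ''A''" and S = "\<lambda>_. A" and e = e and x = x])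
      (use A in \<open>auto intro: Sigma00.intros\<close>)
qed

lemma ACA0_iff: "M \<TTurnstile> ACA0 \<longleftrightarrow> ACA"
proof
  assume ACA0: "M \<TTurnstile> ACA0"
  show ACA
    unfolding ACA_def
  proof (intro allI impI)
    fix p e x and S :: "string \<Rightarrow> 'a set" assume p: "arithmetical p" and S: "\<forall>X. S X \<in> \<S>"
    obtain X where X: "X \<notin> free_svars p"
      using fresh_string[of "free_svars p"] by auto
    then have "comprehension_axiom X x p \<in> ACA0" using p unfolding ACA0_def by blast
    then have "M \<Turnstile> comprehension_axiom X x p" using ACA0 by (auto simp: models_def)
    then show "{a. sat M (e(x := a)) S p} \<in> \<S>"
      by (rule comprehension_instance) (use X S in auto)
  qed
next
  assume ACA: ACA
  have "M \<Turnstile> comprehension_axiom X x p" if "arithmetical p" "X \<notin> free_svars p" for X x p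
    unfolding true_in_def
  proof (intro allI impI)
    fix e and S :: "string \<Rightarrow> 'a set" assume "\<forall>X. S X \<in> \<S>"
    then have "{a. sat M (e(x := a)) S p} \<in> \<S>"
      using ACA that by (auto simp: ACA_def)
    then show "sat M e S (comprehension_axiom X x p)"
      unfolding comprehension_axiom_def sat.simps
      by (rule bexI[rotated]) (use that in \<open>auto simp: sat_fresh_svar\<close>)
  qed
  then show "M \<TTurnstile> ACA0"
    using RCA0 by (auto simp: models_def ACA0_def)
qed

section \<open>Colorings and compactness in a model\<close>

definition edge where "edge C i = {v. pr (pr i v) \<one> \<in> C}"

definition bounded where "bounded A \<longleftrightarrow> (\<exists>b. \<forall>a\<in>A. a \<prec> b)"

definition proper where
  "proper F e \<longleftrightarrow> ((\<exists>u v. u \<in> e \<and> v \<in> e \<and> u \<noteq> v) \<longrightarrow>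
    (\<exists>u v c d. u \<in> e \<and> v \<in> e \<and> pr u c \<in> F \<and> pr v d \<in> F \<and> c \<noteq> d))"

definition conflict_free where
  "conflict_free F e \<longleftrightarrow> (\<exists>j v. v \<in> e \<and> pr v j \<in> F \<and> (\<forall>u. u \<in> e \<and> pr u j \<in> F \<longrightarrow> u = v))"

definition coloring where
  "coloring k F X \<longleftrightarrow> (\<forall>p\<in>F. \<exists>x y. x \<in> X \<and> p = pr x y) \<and>
    (\<forall>x\<in>X. \<exists>y. pr x y \<in> F \<and> (\<forall>z. pr x z \<in> F \<longrightarrow> z = y)) \<and>
    (\<forall>v c. pr v c \<in> F \<longrightarrow> c \<prec> num k)"

definition hypergraph where
  "hypergraph V C \<longleftrightarrow>
    (\<forall>p\<in>C. \<exists>i v y. p = pr (pr i v) y \<and> (y = \<zero> \<or> y = \<one>)) \<and>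
    (\<forall>i v. \<exists>y. pr (pr i v) y \<in> C \<and> (\<forall>z. pr (pr i v) z \<in> C \<longrightarrow> z = y)) \<and>
    (\<forall>i. edge C i \<subseteq> V) \<and> (\<forall>i. bounded (edge C i))"

definition compact where
  "compact k good \<longleftrightarrow> (\<forall>V\<in>\<S>. \<forall>C\<in>\<S>. hypergraph V C \<longrightarrow>
    (\<forall>W\<in>\<S>. \<forall>E\<in>\<S>. W \<subseteq> V \<and> bounded W \<and> bounded E \<and> (\<forall>i\<in>E. edge C i \<subseteq> W) \<longrightarrow>
      (\<exists>F\<in>\<S>. coloring k F W \<and> (\<forall>i\<in>E. good F (edge C i)))) \<longrightarrow>
    (\<exists>F\<in>\<S>. coloring k F V \<and> (\<forall>i. good F (edge C i))))"

lemma sat_hypergraph: "sat M e S hypergraph_fm \<longleftrightarrow> hypergraph (S ''V'') (S ''C'')"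
  by (simp add: hypergraph_fm_def char_sequence_fm_def in_edge_fm_def hypergraph_def edge_def
      Let_def
      bounded_def subset_eq Ball_def)

lemma sat_coloring: "sat M e S (k_coloring_fm k X) \<longleftrightarrow> coloring k (S ''F'') (S X)"
  by (simp add: k_coloring_fm_def function_on_fm_def color_fm_def coloring_def Ball_def Let_def)

lemma sat_partial: "sat M e S finite_partial_hypergraph_fm \<longleftrightarrow>
  S ''W'' \<subseteq> S ''V'' \<and> bounded (S ''W'') \<and> bounded (S ''E'') \<and>
      (\<forall>i\<in>S ''E''. edge (S ''C'') i \<subseteq> S ''W'')"
  by (simp add: finite_partial_hypergraph_fm_def subset_fm_def finite_fm_def in_edge_fm_def
      edge_def Let_def
      bounded_def subset_eq Ball_def)

lemma sat_proper: "sat M e S proper_edge_fm \<longleftrightarrow> proper (S ''F'') (edge (S ''C'') (e ''i''))"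
  by (simp add: proper_edge_fm_def in_edge_fm_def color_fm_def edge_def proper_def Let_def)

lemma sat_conflict_free:
  "sat M e S conflict_free_edge_fm \<longleftrightarrow> conflict_free (S ''F'') (edge (S ''C'') (e ''i''))"
  by (simp add: conflict_free_edge_fm_def in_edge_fm_def color_fm_def edge_def conflict_free_def
      Let_def)

lemma compactness_iff:
  assumes "\<And>e S. sat M e S p \<longleftrightarrow> good (S ''F'') (edge (S ''C'') (e ''i''))"
  shows "M \<Turnstile> compactness_fm k p \<longleftrightarrow> compact k good"
proof -
  have "sat M e S (compactness_fm k p) \<longleftrightarrow> compact k good" for e S
    by (simp add: compactness_fm_def compact_def assms sat_hypergraph sat_partial sat_coloring
        Ball_def)
  then show ?thesis
    unfolding true_in_def by (auto intro: exI[of _ "\<lambda>_. UNIV"])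
qed

lemma proper_compactness_iff: "M \<Turnstile> proper_compactness k \<longleftrightarrow> compact k proper"
  unfolding proper_compactness_def by (rule compactness_iff) (rule sat_proper)

lemma conflict_free_compactness_iff:
  "M \<Turnstile> conflict_free_compactness k \<longleftrightarrow> compact k conflict_free"
  unfolding conflict_free_compactness_def by (rule compactness_iff) (rule sat_conflict_free)

section \<open>Facts shared by proper and conflict-free colorings\<close>

definition good_notion where "good_notion good \<longleftrightarrow> good = proper \<or> good = conflict_free"

text \<open>Used to pass from a coloring to its restriction to a finite part, and from a coloring to
  a code that agrees with it on one edge.\<close>

lemma good_cong:
  assumes "good_notion good" "\<And>v c. v \<in> e \<Longrightarrow> pr v c \<in> F \<longleftrightarrow> pr v c \<in> F'"
  shows "good F e \<longleftrightarrow> good F' e"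
proof -
  have "proper F e \<longleftrightarrow> proper F' e" unfolding proper_def using assms(2) by blast
  moreover have "conflict_free F e \<longleftrightarrow> conflict_free F' e" unfolding conflict_free_def
      using assms(2) by blast
  ultimately show ?thesis using assms(1) unfolding good_notion_def by auto
qed

text \<open>A vertex with a unique color differs in color from every other vertex of the edge.
  Explicit colorings therefore only have to be checked for conflict-freeness.\<close>

lemma good_if_conflict_free:
  assumes "good_notion good" "conflict_free F e" "coloring k F X" "e \<subseteq> X"
  shows "good F e"
proof -
  obtain j v where v: "v \<in> e" "pr v j \<in> F" "\<And>u. u \<in> e \<Longrightarrow> pr u j \<in> F \<Longrightarrow> u = v"
    using assms(2) unfolding conflict_free_def by blast
  have "proper F e"
    unfolding proper_def
  proof
    assume "\<exists>u w. u \<in> e \<and> w \<in> e \<and> u \<noteq> w"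
    then obtain u where u: "u \<in> e" "u \<noteq> v" by blast
    then obtain c where "pr u c \<in> F" using assms(3,4) unfolding coloring_def by blast
    with u v show "\<exists>u v c d. u \<in> e \<and> v \<in> e \<and> pr u c \<in> F \<and> pr v d \<in> F \<and> c \<noteq> d" by blast
  qed
  then show ?thesis using assms(1,2) unfolding good_notion_def by auto
qed

lemma coloring_unique:
  assumes "coloring k F X" "v \<in> X" "pr v c \<in> F" "pr v d \<in> F"
  shows "c = d"
proof -
  obtain y where "\<And>z. pr v z \<in> F \<Longrightarrow> z = y"
    using assms(1,2) unfolding coloring_def by meson
  then show ?thesis using assms(3,4) by metis
qed

text \<open>If both vertices had the same color, the edge would show neither two colors nor a color
  occurring once, so both notions fail.\<close>

lemma good_pairD:
  assumes "good_notion good" "good F {u, v}" "coloring k F X" "{u, v} \<subseteq> X" "u \<noteq> v" "pr u c \<in> F"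
      "pr v d \<in> F"
  shows "c \<noteq> d"
proof
  assume "c = d"
  then have all: "pr w c \<in> F" "w \<in> X" if "w \<in> {u, v}" for w
    using assms(4,6,7) that by auto
  have uniq: "x = c" if "pr w x \<in> F" "w \<in> {u, v}" for w x
    by (rule coloring_unique[OF assms(3) all(2)[OF that(2)] that(1) all(1)[OF that(2)]])
  show False
    using assms(1) unfolding good_notion_def
  proof
    assume "good = proper"
    moreover have "\<exists>x y. x \<in> {u, v} \<and> y \<in> {u, v} \<and> x \<noteq> y"
      using assms(5) by blast
    ultimately obtain w w' x x' where
      "w \<in> {u, v}" "w' \<in> {u, v}" "pr w x \<in> F" "pr w' x' \<in> F" "x \<noteq> x'"
      using assms(2) unfolding proper_def by meson
    then show False using uniq[of w x] uniq[of w' x'] by simp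
  next
    assume "good = conflict_free"
    with assms(2) obtain w j where
      w: "w \<in> {u, v}" "pr w j \<in> F" "\<And>u'. u' \<in> {u, v} \<Longrightarrow> pr u' j \<in> F \<Longrightarrow> u' = w"
      unfolding conflict_free_def by meson
    then have "j = c" using uniq[of w j] by blast
    then have "u = w" "v = w" using w(3)[of u] w(3)[of v] all by auto
    then show False using assms(5) by blast
  qed
qed

lemma coloring_graph:
  assumes "F = {p. \<exists>v. p = pr v (col v)}" "\<And>v. col v \<prec> num k"
  shows "coloring k F UNIV"
    "conflict_free F e \<longleftrightarrow> (\<exists>v\<in>e. \<forall>u\<in>e. col u = col v \<longrightarrow> u = v)"
proof -
  have F_iff: "pr v c \<in> F \<longleftrightarrow> c = col v" for v c unfolding assms(1) by auto
  show "coloring k F UNIV"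
    unfolding coloring_def F_iff using assms by auto
  show "conflict_free F e \<longleftrightarrow> (\<exists>v\<in>e. \<forall>u\<in>e. col u = col v \<longrightarrow> u = v)"
    unfolding conflict_free_def F_iff by (simp add: Bex_def Ball_def) metis
qed

text \<open>Interface for the reversal: edges may be given by their incidence relation, every number
  is a vertex, and finite parts may be colored on all vertices at once.\<close>

lemma compact_total:
  assumes good: "good_notion good" and compact: "compact k good"
    and B: "{p. \<exists>i v. p = pr i v \<and> v \<in> edg i} \<in> \<S>"
    and bdd: "\<And>i. bounded (edg i)"
    and fin: "\<And>b. \<exists>F\<in>\<S>. coloring k F UNIV \<and> (\<forall>i. i \<prec> b \<longrightarrow> good F (edg i))"
  shows "\<exists>F\<in>\<S>. coloring k F UNIV \<and> (\<forall>i. good F (edg i))"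
proof -
  define B where "B = {p. \<exists>i v. p = pr i v \<and> v \<in> edg i}"
  have B_iff: "pr i v \<in> B \<longleftrightarrow> v \<in> edg i" for i v by (auto simp: B_def)
  \<comment> \<open>\<open>C\<close> must be the graph of the characteristic functions, so it also
    records the value 0 for non-members.\<close>
  define C where "C = {p. \<exists>i. i \<prec> p \<oplus> \<one> \<and> (\<exists>v. v \<prec> p \<oplus> \<one> \<and> (p = pr (pr i v) \<one> \<and> pr i v \<in> B \<or>
    p = pr (pr i v) \<zero> \<and> pr i v \<notin> B))}"
  have C: "C \<in> \<S>"
    unfolding C_def
    by (rule Sigma00_setI[where x = "''p''" and S = "\<lambda>_. B" and p =
        "\<^bold>\<exists>''i''. NVar ''i'' \<^bold>< NVar ''p'' \<^bold>+ \<^bold>1 \<^bold>\<and> (\<^bold>\<exists>''v''. NVar ''v'' \<^bold>< NVar ''p'' \<^bold>+ \<^bold>1 \<^bold>\<and>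
          (NVar ''p'' \<^bold>= \<^bold>\<langle>\<^bold>\<langle>NVar ''i'', NVar ''v''\<^bold>\<rangle>, \<^bold>1\<^bold>\<rangle> \<^bold>\<and> \<^bold>\<langle>NVar ''i'', NVar ''v''\<^bold>\<rangle> \<^bold>\<in> ''B'' \<^bold>\<or>
           NVar ''p'' \<^bold>= \<^bold>\<langle>\<^bold>\<langle>NVar ''i'', NVar ''v''\<^bold>\<rangle>, \<^bold>0\<^bold>\<rangle> \<^bold>\<and> \<^bold>\<not> \<^bold>\<langle>NVar ''i'', NVar ''v''\<^bold>\<rangle> \<^bold>\<in> ''B''))"])
      (use B[folded B_def] in \<open>auto intro!: Sigma00.intros\<close>)
  have le: "i \<preceq> pr (pr i v) y" "v \<preceq> pr (pr i v) y" for i v y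
    using fst_le_pr[of "pr i v" y] fst_le_pr[of i v] snd_le_pr[of v i] by (meson ord.order_trans)+
  have C_iff: "pr (pr i v) y \<in> C \<longleftrightarrow> y = (if v \<in> edg i then \<one> else \<zero>)" for i v y
    unfolding C_def using le by (auto simp: less_succ_le B_iff)
  have edge: "edge C i = edg i" for i
    unfolding edge_def C_iff by auto
  have "\<exists>i v y. p = pr (pr i v) y \<and> (y = \<zero> \<or> y = \<one>)" if "p \<in> C" for p
    using that unfolding C_def by blast
  then have "hypergraph UNIV C"
    unfolding hypergraph_def edge C_iff using bdd by auto
  moreover have "\<exists>F\<in>\<S>. coloring k F W \<and> (\<forall>i\<in>E. good F (edge C i))"
    if W: "W \<in> \<S>" and E: "E \<in> \<S>" "bounded E" "\<forall>i\<in>E. edge C i \<subseteq> W" for W E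
  proof -
    obtain b where b: "\<And>i. i \<in> E \<Longrightarrow> i \<prec> b" using E unfolding bounded_def by blast
    obtain F where F: "F \<in> \<S>" "coloring k F UNIV" "\<And>i. i \<prec> b \<Longrightarrow> good F (edg i)"
      using fin by blast
    \<comment> \<open>A coloring of the partial hypergraph has to be a function with domain exactly
      \<open>W\<close>.\<close>
    define F' where "F' = {p. \<exists>v. v \<prec> p \<oplus> \<one> \<and> (\<exists>c. c \<prec> p \<oplus> \<one> \<and> p = pr v c \<and> v \<in> W \<and> p \<in> F)}"
    have F': "F' \<in> \<S>"
      unfolding F'_def
      by (rule Sigma00_setI[where x = "''p''" and S = "(\<lambda>_. F)(''W'' := W)" and p =
          "\<^bold>\<exists>''v''. NVar ''v'' \<^bold>< NVar ''p'' \<^bold>+ \<^bold>1 \<^bold>\<and> (\<^bold>\<exists>''c''. NVar ''c'' \<^bold>< NVar ''p'' \<^bold>+ \<^bold>1 \<^bold>\<and>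
            NVar ''p'' \<^bold>= \<^bold>\<langle>NVar ''v'', NVar ''c''\<^bold>\<rangle> \<^bold>\<and> NVar ''v'' \<^bold>\<in> ''W'' \<^bold>\<and> NVar ''p'' \<^bold>\<in> ''F'')"])
        (use W F in \<open>auto intro!: Sigma00.intros\<close>)
    have F_iff: "pr v c \<in> F' \<longleftrightarrow> v \<in> W \<and> pr v c \<in> F" for v c
      unfolding F'_def by (auto simp: less_succ_le)
    have "\<exists>v c. v \<in> W \<and> p = pr v c" if "p \<in> F'" for p
      using that unfolding F'_def by blast
    then have "coloring k F' W"
      using F(2) unfolding coloring_def F_iff by blast
    moreover have "good F' (edge C i)" if "i \<in> E" for i
    proof -
      have "good F (edg i)" using F(3) b that by blast
      moreover have "pr v c \<in> F \<longleftrightarrow> pr v c \<in> F'" if "v \<in> edg i" for v c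
        unfolding F_iff using that E(3) \<open>i \<in> E\<close> unfolding edge by blast
      ultimately show ?thesis using good_cong[OF good] unfolding edge by blast
    qed
    ultimately show ?thesis using F' by blast
  qed
  ultimately obtain F where "F \<in> \<S>" "coloring k F UNIV" "\<forall>i. good F (edge C i)"
    using compact[unfolded compact_def, rule_format, OF set_UNIV C] by blast
  then show ?thesis unfolding edge by blast
qed

section \<open>Compactness implies arithmetical comprehension\<close>

text \<open>These discharge the bounds of \<open>bex_fm\<close> for components of nested
  pairs.\<close>

lemma le_pr_fst: "a \<preceq> b \<Longrightarrow> a \<preceq> pr b c" and le_pr_snd: "a \<preceq> c \<Longrightarrow> a \<preceq> pr b c"
  using fst_le_pr[of b c] snd_le_pr[of c b] by (meson ord.order_trans)+

lemma bounded_finite: "finite A \<Longrightarrow> bounded A"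
proof (induction A rule: finite_induct)
  case empty
  show ?case by (simp add: bounded_def)
next
  case (insert a A)
  then obtain b where b: "\<And>x. x \<in> A \<Longrightarrow> x \<prec> b" unfolding bounded_def by blast
  have "x \<prec> ord.max (a \<oplus> \<one>) b" if "x \<in> insert a A" for x
    using that b by (auto simp: ord.less_max_iff_disj less_succ)
  then show ?case unfolding bounded_def by blast
qed

text \<open>This rule would rewrite \<open>\<one> \<oplus> \<one>\<close> to a numeral of the interpreted semiring.\<close>

declare mn.one_add_one [simp del]

lemma one_neq_zero [simp]: "\<one> \<noteq> \<zero>" "\<zero> \<noteq> \<one>"
  using mn.zero_neq_one by metis+

lemma two_neq [simp]: "\<one> \<oplus> \<one> \<noteq> \<one>" "\<one> \<noteq> \<one> \<oplus> \<one>" "\<zero> \<noteq> n \<oplus> \<one>"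
  using succ_nonzero[of n] succ_inject[of \<zero> \<one>] one_neq_zero unfolding zero_add by metis+

context
  fixes k :: nat and D :: "'a set"
  assumes k: "k \<ge> 2" and D: "D \<in> \<S>" and fun_D: "\<And>n s s'. pr n s \<in> D \<Longrightarrow> pr n s' \<in> D \<Longrightarrow> s = s'"
begin

text \<open>The vertices \<open>x\<^sub>i\<close>, \<open>u\<^sub>n\<close> and the third vertex belonging to \<open>D(n) = s\<close> are the pairs
  \<open>(0, i)\<close>, \<open>(1, n)\<close> and \<open>(2, (n, s))\<close>. The edges of the clique, the edges \<open>{u\<^sub>n, x\<^sub>0, \<dots>}\<close> and the
  edges \<open>{u\<^sub>n, x\<^sub>i}\<close> have the indices \<open>(0, (i, j))\<close>, \<open>(1, n)\<close> and \<open>(2, (i, (n, s)))\<close>; every other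
  index gets the edge \<open>{x\<^sub>0}\<close>, because an empty edge admits no conflict-free coloring.\<close>

definition nontrivial where
  "nontrivial = {a. (\<exists>i j. i \<prec> num k \<and> j \<prec> num k \<and> a = pr \<zero> (pr i j)) \<or> (\<exists>n. a = pr \<one> n) \<or>
    (\<exists>i n s. i \<prec> num k \<and> i \<noteq> \<zero> \<and> pr n s \<in> D \<and> a = pr (\<one> \<oplus> \<one>) (pr i (pr n s)))}"

definition gadget where
  "gadget a = {v. (\<exists>i j. i \<prec> num k \<and> j \<prec> num k \<and> a = pr \<zero> (pr i j) \<and> (v = pr \<zero> i \<or> v = pr \<zero> j)) \<or>
    (\<exists>n. a = pr \<one> n \<and> (v = pr \<zero> \<zero> \<or> v = pr \<one> n \<or> (\<exists>s. v = pr (\<one> \<oplus> \<one>) (pr n s) \<and> pr n s \<in> D))) \<or>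
    (\<exists>i n s. i \<prec> num k \<and> i \<noteq> \<zero> \<and> pr n s \<in> D \<and> a = pr (\<one> \<oplus> \<one>) (pr i (pr n s)) \<and>
        (v = pr \<one> n \<or> v = pr \<zero> i)) \<or>
    (a \<notin> nontrivial \<and> v = pr \<zero> \<zero>)}"

lemma gadget_simps:
  "i \<prec> num k \<Longrightarrow> j \<prec> num k \<Longrightarrow> gadget (pr \<zero> (pr i j)) = {pr \<zero> i, pr \<zero> j}"
  "gadget (pr \<one> n) = {pr \<zero> \<zero>, pr \<one> n} \<union> {pr (\<one> \<oplus> \<one>) (pr n s) | s. pr n s \<in> D}"
  "i \<prec> num k \<Longrightarrow> i \<noteq> \<zero> \<Longrightarrow> pr n s \<in> D \<Longrightarrow> gadget (pr (\<one> \<oplus> \<one>) (pr i (pr n s))) = {pr \<one> n, pr \<zero> i}"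
  "a \<notin> nontrivial \<Longrightarrow> gadget a = {pr \<zero> \<zero>}"
  by (auto simp: gadget_def nontrivial_def) blast+

lemma gadget_cases:
  obtains (clique) i j where "a = pr \<zero> (pr i j)" "i \<prec> num k" "j \<prec> num k"
  | (test) n where "a = pr \<one> n"
  | (force) i n s where "a = pr (\<one> \<oplus> \<one>) (pr i (pr n s))" "i \<prec> num k" "i \<noteq> \<zero>" "pr n s \<in> D"
  | (trivial) "a \<notin> nontrivial"
proof (cases "a \<in> nontrivial")
  case True
  then show ?thesis
    unfolding nontrivial_def mem_Collect_eq by (elim disjE exE conjE) (rule clique test force;
        assumption)+
qed (rule trivial)

lemma set_nontrivial: "nontrivial \<in> \<S>"
  unfolding nontrivial_def
  by (rule Sigma00_setI[where x = "''p''" and S = "\<lambda>_. D" and p =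
      "bex_fm ''p'' [''i'', ''j''] (NVar ''i'' \<^bold>< numeral_tm k \<^bold>\<and> NVar ''j'' \<^bold>< numeral_tm k \<^bold>\<and>
         NVar ''p'' \<^bold>= \<^bold>\<langle>\<^bold>0, \<^bold>\<langle>NVar ''i'', NVar ''j''\<^bold>\<rangle>\<^bold>\<rangle>) \<^bold>\<or>
       bex_fm ''p'' [''n''] (NVar ''p'' \<^bold>= \<^bold>\<langle>\<^bold>1, NVar ''n''\<^bold>\<rangle>) \<^bold>\<or>
       bex_fm ''p'' [''i'', ''n'', ''s''] (NVar ''i'' \<^bold>< numeral_tm k \<^bold>\<and> \<^bold>\<not> NVar ''i'' \<^bold>= \<^bold>0 \<^bold>\<and>
         \<^bold>\<langle>NVar ''n'', NVar ''s''\<^bold>\<rangle> \<^bold>\<in> ''D'' \<^bold>\<and>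
         NVar ''p'' \<^bold>= \<^bold>\<langle>\<^bold>1 \<^bold>+ \<^bold>1, \<^bold>\<langle>NVar ''i'', \<^bold>\<langle>NVar ''n'', NVar ''s''\<^bold>\<rangle>\<^bold>\<rangle>\<^bold>\<rangle>)"])
    (use D in \<open>auto intro!: Sigma00.intros simp: less_succ_le le_pr_fst le_pr_snd\<close>)

lemma set_gadget: "{p. \<exists>a v. p = pr a v \<and> v \<in> gadget a} \<in> \<S>"
  unfolding gadget_def
  by (rule Sigma00_setI[where x = "''p''" and S = "(\<lambda>_. D)(''I'' := nontrivial)" and p =
      "bex_fm ''p'' [''a'', ''v''] (NVar ''p'' \<^bold>= \<^bold>\<langle>NVar ''a'', NVar ''v''\<^bold>\<rangle> \<^bold>\<and>
       (bex_fm ''p'' [''i'', ''j''] (NVar ''i'' \<^bold>< numeral_tm k \<^bold>\<and> NVar ''j'' \<^bold>< numeral_tm k \<^bold>\<and>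
         NVar ''a'' \<^bold>= \<^bold>\<langle>\<^bold>0, \<^bold>\<langle>NVar ''i'', NVar ''j''\<^bold>\<rangle>\<^bold>\<rangle> \<^bold>\<and>
         (NVar ''v'' \<^bold>= \<^bold>\<langle>\<^bold>0, NVar ''i''\<^bold>\<rangle> \<^bold>\<or> NVar ''v'' \<^bold>= \<^bold>\<langle>\<^bold>0, NVar ''j''\<^bold>\<rangle>)) \<^bold>\<or>
       bex_fm ''p'' [''n''] (NVar ''a'' \<^bold>= \<^bold>\<langle>\<^bold>1, NVar ''n''\<^bold>\<rangle> \<^bold>\<and>
         (NVar ''v'' \<^bold>= \<^bold>\<langle>\<^bold>0, \<^bold>0\<^bold>\<rangle> \<^bold>\<or> NVar ''v'' \<^bold>= \<^bold>\<langle>\<^bold>1, NVar ''n''\<^bold>\<rangle> \<^bold>\<or>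
          bex_fm ''p'' [''s''] (NVar ''v'' \<^bold>= \<^bold>\<langle>\<^bold>1 \<^bold>+ \<^bold>1, \<^bold>\<langle>NVar ''n'', NVar ''s''\<^bold>\<rangle>\<^bold>\<rangle> \<^bold>\<and>
            \<^bold>\<langle>NVar ''n'', NVar ''s''\<^bold>\<rangle> \<^bold>\<in> ''D''))) \<^bold>\<or>
       bex_fm ''p'' [''i'', ''n'', ''s''] (NVar ''i'' \<^bold>< numeral_tm k \<^bold>\<and> \<^bold>\<not> NVar ''i'' \<^bold>= \<^bold>0 \<^bold>\<and>
         \<^bold>\<langle>NVar ''n'', NVar ''s''\<^bold>\<rangle> \<^bold>\<in> ''D'' \<^bold>\<and>
         NVar ''a'' \<^bold>= \<^bold>\<langle>\<^bold>1 \<^bold>+ \<^bold>1, \<^bold>\<langle>NVar ''i'', \<^bold>\<langle>NVar ''n'', NVar ''s''\<^bold>\<rangle>\<^bold>\<rangle>\<^bold>\<rangle> \<^bold>\<and>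
         (NVar ''v'' \<^bold>= \<^bold>\<langle>\<^bold>1, NVar ''n''\<^bold>\<rangle> \<^bold>\<or> NVar ''v'' \<^bold>= \<^bold>\<langle>\<^bold>0, NVar ''i''\<^bold>\<rangle>)) \<^bold>\<or>
       \<^bold>\<not> NVar ''a'' \<^bold>\<in> ''I'' \<^bold>\<and> NVar ''v'' \<^bold>= \<^bold>\<langle>\<^bold>0, \<^bold>0\<^bold>\<rangle>))"])
    (use D set_nontrivial in \<open>auto intro!: Sigma00.intros simp: less_succ_le le_pr_fst le_pr_snd\<close>)

lemma bounded_gadget: "bounded (gadget a)"
proof -
  have "finite (gadget a)"
  proof (cases a rule: gadget_cases)
    case (test n)
    \<comment> \<open>Since \<open>D\<close> is single-valued, a test edge has at most one third
      vertex.\<close>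
    have "finite {pr (\<one> \<oplus> \<one>) (pr n s) | s. pr n s \<in> D}"
    proof (cases "\<exists>s. pr n s \<in> D")
      case True
      then obtain s where "pr n s \<in> D" ..
      then have "{pr (\<one> \<oplus> \<one>) (pr n s) | s. pr n s \<in> D} \<subseteq> {pr (\<one> \<oplus> \<one>) (pr n s)}"
        using fun_D by blast
      then show ?thesis by (rule finite_subset) simp
    qed simp
    then show ?thesis by (simp add: test gadget_simps)
  qed (simp_all add: gadget_simps)
  then show ?thesis by (rule bounded_finite)
qed

lemma zero_one_less: "\<zero> \<prec> num k" "\<one> \<prec> num k"
proof -
  have "num j \<prec> num k" if "j < k" for j using that by (auto simp: less_num_iff)
  from this[of 0] this[of "Suc 0"] k show "\<zero> \<prec> num k" "\<one> \<prec> num k" by auto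
qed

text \<open>\<open>x_i\<close> gets color \<open>i\<close>, every third vertex gets 1, and
  \<open>u_n\<close> gets 0 or 1 according to whether a value of \<open>D\<close> at
  \<open>n\<close> shows up below \<open>b\<close>.\<close>

lemma finite_coloring:
  assumes good: "good_notion good"
  shows "\<exists>F\<in>\<S>. coloring k F UNIV \<and> (\<forall>a. a \<prec> b \<longrightarrow> good F (gadget a))"
proof -
  \<comment> \<open>The vertices of color 1 outside the clique. Bounding the search by
    \<open>b\<close> is what makes this a set of the model.\<close>
  define A where "A = {v. (\<exists>n. v = pr \<one> n \<and> \<not> (\<exists>s. s \<prec> b \<and> pr n s \<in> D)) \<or> (\<exists>q. v = pr (\<one> \<oplus> \<one>) q)}"
  define X where "X = {v. \<exists>i. i \<prec> num k \<and> v = pr \<zero> i}"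
  define col where "col v = (if v \<in> X then THE i. v = pr \<zero> i
    else if v \<in> A then \<one> else \<zero>)" for v
  have A: "A \<in> \<S>"
    unfolding A_def
    by (rule Sigma00_setI[where x = "''p''" and S = "\<lambda>_. D" and e = "\<lambda>_. b" and p =
      "bex_fm ''p'' [''n''] (NVar ''p'' \<^bold>= \<^bold>\<langle>\<^bold>1, NVar ''n''\<^bold>\<rangle> \<^bold>\<and>
         \<^bold>\<not> (\<^bold>\<exists>''s''. NVar ''s'' \<^bold>< NVar ''b'' \<^bold>\<and> \<^bold>\<langle>NVar ''n'', NVar ''s''\<^bold>\<rangle> \<^bold>\<in> ''D'')) \<^bold>\<or>
       bex_fm ''p'' [''n''] (NVar ''p'' \<^bold>= \<^bold>\<langle>\<^bold>1 \<^bold>+ \<^bold>1, NVar ''n''\<^bold>\<rangle>)"])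
      (use D in \<open>auto intro!: Sigma00.intros simp: less_succ_le le_pr_fst le_pr_snd\<close>)
  have X: "X \<in> \<S>"
    unfolding X_def
    by (rule Sigma00_setI[where x = "''p''" and S = "\<lambda>_. D" and p =
      "bex_fm ''p'' [''i''] (NVar ''i'' \<^bold>< numeral_tm k \<^bold>\<and> NVar ''p'' \<^bold>= \<^bold>\<langle>\<^bold>0, NVar ''i''\<^bold>\<rangle>)"])
      (use D in \<open>auto intro!: Sigma00.intros simp: less_succ_le\<close>)
  define F where "F = {p. \<exists>v. p = pr v (col v)}"
  \<comment> \<open>Rewrites the case distinction and the description operator of \<open>col\<close>
    into a relation that a formula can express.\<close>
  have col_eq: "c = col v \<longleftrightarrow> (\<exists>i. i \<prec> num k \<and> v = pr \<zero> i \<and> c = i) \<or>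
      v \<notin> X \<and> (v \<in> A \<and> c = \<one> \<or> v \<notin> A \<and> c = \<zero>)" for v c
    unfolding col_def X_def by auto
  have "F = {p. \<exists>v c. p = pr v c \<and> c = col v}" unfolding F_def by auto
  also have "\<dots> \<in> \<S>"
    unfolding col_eq
    by (rule Sigma00_setI[where x = "''p''" and S = "(\<lambda>_. A)(''X'' := X)" and p =
      "bex_fm ''p'' [''v'', ''c''] (NVar ''p'' \<^bold>= \<^bold>\<langle>NVar ''v'', NVar ''c''\<^bold>\<rangle> \<^bold>\<and>
         (bex_fm ''p'' [''i''] (NVar ''i'' \<^bold>< numeral_tm k \<^bold>\<and> NVar ''v'' \<^bold>= \<^bold>\<langle>\<^bold>0, NVar ''i''\<^bold>\<rangle> \<^bold>\<and>
             NVar ''c'' \<^bold>= NVar ''i'') \<^bold>\<or>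
          \<^bold>\<not> NVar ''v'' \<^bold>\<in> ''X'' \<^bold>\<and>
          (NVar ''v'' \<^bold>\<in> ''A'' \<^bold>\<and> NVar ''c'' \<^bold>= \<^bold>1 \<^bold>\<or> \<^bold>\<not> NVar ''v'' \<^bold>\<in> ''A'' \<^bold>\<and> NVar ''c'' \<^bold>= \<^bold>0)))"])
      (use A X in \<open>auto intro!: Sigma00.intros simp: less_succ_le le_pr_fst le_pr_snd\<close>)
  finally have F: "F \<in> \<S>" .
  have col_less: "col v \<prec> num k" for v
    using zero_one_less unfolding col_def X_def by auto
  note cf = coloring_graph[OF F_def col_less]
  have col_x: "i \<prec> num k \<Longrightarrow> col (pr \<zero> i) = i" for i
    unfolding col_def X_def by auto
  have col_u: "col (pr \<one> n) = (if \<exists>s. s \<prec> b \<and> pr n s \<in> D then \<zero> else \<one>)" for n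
    unfolding col_def A_def X_def by auto
  have col_y: "col (pr (\<one> \<oplus> \<one>) q) = \<one>" for q
    unfolding col_def A_def X_def by auto
  have "conflict_free F (gadget a)" if "a \<prec> b" for a
    unfolding cf
  proof (cases a rule: gadget_cases)
    case (clique i j)
    then show "\<exists>v\<in>gadget a. \<forall>u\<in>gadget a. col u = col v \<longrightarrow> u = v"
      by (auto simp: gadget_simps col_x)
  next
    case (test n)
    show "\<exists>v\<in>gadget a. \<forall>u\<in>gadget a. col u = col v \<longrightarrow> u = v"
    proof (cases "\<exists>s. s \<prec> b \<and> pr n s \<in> D")
      case True
      then obtain s where s: "pr n s \<in> D" by blast
      \<comment> \<open>Here \<open>u_n\<close> and \<open>x_0\<close> share color 0, so the third
        vertex has to be the uniquely colored one.\<close>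
      show ?thesis
        by (rule bexI[of _ "pr (\<one> \<oplus> \<one>) (pr n s)"])
          (use s True fun_D zero_one_less in \<open>auto simp: test gadget_simps col_x col_y col_u\<close>)
    next
      case False
      \<comment> \<open>Here \<open>u_n\<close> and a possible third vertex with value at least
        \<open>b\<close> have color 1, leaving \<open>x_0\<close> alone with color 0.\<close>
      show ?thesis
        by (rule bexI[of _ "pr \<zero> \<zero>"])
          (use False zero_one_less in \<open>auto simp: test gadget_simps col_x col_y col_u\<close>)
    qed
  next
    case (force i n s)
    \<comment> \<open>The index contains \<open>s\<close>, so the search below \<open>b\<close> has
      found it and \<open>u_n\<close> has color 0, while \<open>x_i\<close> has color
      \<open>i\<close> different from 0.\<close>
    have "s \<preceq> a" by (simp add: force le_pr_fst le_pr_snd)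
    then have "s \<prec> b" using that by order
    then show "\<exists>v\<in>gadget a. \<forall>u\<in>gadget a. col u = col v \<longrightarrow> u = v"
      using force by (auto simp: gadget_simps col_x col_u)
  next
    case trivial
    then show "\<exists>v\<in>gadget a. \<forall>u\<in>gadget a. col u = col v \<longrightarrow> u = v"
      by (auto simp: gadget_simps)
  qed
  then have "good F (gadget a)" if "a \<prec> b" for a
    using good_if_conflict_free[OF good _ cf(1)] that by blast
  with F cf(1) show ?thesis by blast
qed

lemma domain_set:
  assumes good: "good_notion good" and compact: "compact k good"
  shows "{n. \<exists>s. pr n s \<in> D} \<in> \<S>"
proof -
  obtain F where F: "F \<in> \<S>" "coloring k F UNIV" "\<And>a. good F (gadget a)"
    using compact_total[OF good compact set_gadget bounded_gadget finite_coloring[OF good]] by blast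
  have ex: "\<exists>c. pr v c \<in> F" for v using F(2) unfolding coloring_def by blast
  define col where "col v = (SOME c. pr v c \<in> F)" for v
  have col: "pr v (col v) \<in> F" for v unfolding col_def using ex by (rule someI_ex)
  have F_iff: "pr v c \<in> F \<longleftrightarrow> c = col v" for v c
    using coloring_unique[OF F(2) UNIV_I _ col] col by metis
  have col_less: "col v \<prec> num k" for v
    using F(2) col unfolding coloring_def by blast
  have pair: "col u \<noteq> col v" if "gadget a = {u, v}" "u \<noteq> v" for a u v
    using good_pairD[OF good _ F(2) _ that(2) col col] F(3)[of a] that(1) by simp
  have "(\<exists>s. pr n s \<in> D) \<longleftrightarrow> col (pr \<one> n) = col (pr \<zero> \<zero>)" for n
  proof
    assume "\<exists>s. pr n s \<in> D"
    then obtain s where s: "pr n s \<in> D" ..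
    have ne: "col (pr \<one> n) \<noteq> col (pr \<zero> i)" if "i \<prec> num k" "i \<noteq> \<zero>" for i
      by (rule pair[OF gadget_simps(3)[OF that s]]) simp
    let ?f = "\<lambda>i. col (pr \<zero> (num i))"
    have inj: "inj_on ?f {..<k}"
    proof (rule inj_onI, rule ccontr)
      fix i j assume ij: "i \<in> {..<k}" "j \<in> {..<k}" "?f i = ?f j" "i \<noteq> j"
      then have "num i \<prec> num k" "num j \<prec> num k" by (auto simp: less_num_iff)
      from pair[OF gadget_simps(1)[OF this]] ij show False by simp
    qed
    \<comment> \<open>The clique uses \<open>k\<close> distinct colors out of \<open>k\<close>, so
      every color occurs on it. As \<open>u_n\<close> avoids the colors of all \<open>x_i\<close>
      with \<open>i > 0\<close>, only that of \<open>x_0\<close> remains.\<close>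
    have "?f ` {..<k} = num ` {..<k}"
    proof (rule card_subset_eq)
      show "?f ` {..<k} \<subseteq> num ` {..<k}"
        using col_less less_num_iff by (auto simp: image_iff Bex_def)
      have "inj_on num {..<k}" by (auto intro: inj_onI)
      with inj show "card (?f ` {..<k}) = card (num ` {..<k})" by (simp add: card_image)
    qed simp
    moreover have "col (pr \<one> n) \<in> num ` {..<k}"
      using col_less[of "pr \<one> n"] by (auto simp: less_num_iff)
    ultimately obtain i where i: "i < k" "col (pr \<one> n) = ?f i"
        by (metis (no_types, lifting) imageE lessThan_iff)
    then have "num i \<prec> num k" by (auto simp: less_num_iff)
    with ne[of "num i"] i show "col (pr \<one> n) = col (pr \<zero> \<zero>)"
      by (cases "num i = \<zero>") auto
  next
    assume eq: "col (pr \<one> n) = col (pr \<zero> \<zero>)"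
    show "\<exists>s. pr n s \<in> D"
    proof (rule ccontr)
      assume "\<not> ?thesis"
      then have "gadget (pr \<one> n) = {pr \<zero> \<zero>, pr \<one> n}" by (auto simp: gadget_simps)
      from pair[OF this] eq show False by simp
    qed
  qed
  \<comment> \<open>\<open>col\<close> was picked by choice outside the model; equality of two
    colors is restated through \<open>F\<close> with a quantifier bounded by \<open>k\<close>, so
    that Sigma00 comprehension suffices.\<close>
  then have eq: "{n. \<exists>s. pr n s \<in> D} = {n. \<exists>c. c \<prec> num k \<and> pr (pr \<one> n) c \<in> F \<and> pr (pr \<zero> \<zero>) c \<in> F}"
    using col_less by (auto simp: F_iff)
  show ?thesis
    unfolding eq
    by (rule Sigma00_setI[where x = "''n''" and S = "\<lambda>_. F" and p =
      "\<^bold>\<exists>''c''. NVar ''c'' \<^bold>< numeral_tm k \<^bold>\<and> \<^bold>\<langle>\<^bold>\<langle>\<^bold>1, NVar ''n''\<^bold>\<rangle>, NVar ''c''\<^bold>\<rangle> \<^bold>\<in> ''F'' \<^bold>\<and>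
         \<^bold>\<langle>\<^bold>\<langle>\<^bold>0, \<^bold>0\<^bold>\<rangle>, NVar ''c''\<^bold>\<rangle> \<^bold>\<in> ''F''"])
      (use F in \<open>auto intro!: Sigma00.intros\<close>)
qed

end

lemma Sigma01_closed_if_compact:
  assumes "k \<ge> 2" "good_notion good" "compact k good"
  shows Sigma01_closed
  unfolding Sigma01_closed_def
proof
  fix A assume A: "A \<in> \<S>"
  \<comment> \<open>Keeping only least witnesses makes the relation single-valued, needs just a
    bounded quantifier, and leaves the projection unchanged.\<close>
  define D where "D = {p. \<exists>a b. p = pr a b \<and> pr a b \<in> A \<and> (\<forall>c. c \<prec> b \<longrightarrow> pr a c \<notin> A)}"
  have D_iff: "pr a b \<in> D \<longleftrightarrow> pr a b \<in> A \<and> (\<forall>c. c \<prec> b \<longrightarrow> pr a c \<notin> A)" for a b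
    unfolding D_def by auto
  have "D \<in> \<S>"
    unfolding D_def
    by (rule Sigma00_setI[where x = "''p''" and S = "\<lambda>_. A" and p =
      "bex_fm ''p'' [''a'', ''b''] (NVar ''p'' \<^bold>= \<^bold>\<langle>NVar ''a'', NVar ''b''\<^bold>\<rangle> \<^bold>\<and>
          \<^bold>\<langle>NVar ''a'', NVar ''b''\<^bold>\<rangle> \<^bold>\<in> ''A'' \<^bold>\<and>
         (\<^bold>\<forall>''c''. NVar ''c'' \<^bold>< NVar ''b'' \<^bold>\<longrightarrow> \<^bold>\<not> \<^bold>\<langle>NVar ''a'', NVar ''c''\<^bold>\<rangle> \<^bold>\<in> ''A''))"])
      (use A in \<open>auto intro!: Sigma00.intros simp: less_succ_le\<close>)
  moreover have "b = c" if "pr a b \<in> D" "pr a c \<in> D" for a b c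
    using that less_linear unfolding D_iff by metis
  ultimately have "{a. \<exists>b. pr a b \<in> D} \<in> \<S>"
    by (rule domain_set[OF assms(1) _ _ assms(2,3)])
  moreover have "(\<exists>b. pr a b \<in> D) \<longleftrightarrow> (\<exists>b. pr a b \<in> A)" for a
  proof
    assume "\<exists>b. pr a b \<in> A"
    then obtain b where "b \<in> {b. pr a b \<in> A}" by blast
    moreover have "{b. pr a b \<in> A} \<in> \<S>"
      by (rule Sigma00_setI[where x = "''b''" and S = "\<lambda>_. A" and e = "\<lambda>_. a" and p =
        "\<^bold>\<langle>NVar ''a'', NVar ''b''\<^bold>\<rangle> \<^bold>\<in> ''A''"]) (use A in \<open>auto intro!: Sigma00.intros\<close>)
    ultimately obtain m where "m \<in> {b. pr a b \<in> A}" "\<And>x. x \<prec> m \<Longrightarrow> x \<notin> {b. pr a b \<in> A}"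
      using set_least by metis
    then show "\<exists>b. pr a b \<in> D" unfolding D_iff by blast
  qed (auto simp: D_iff)
  ultimately show "{a. \<exists>b. pr a b \<in> A} \<in> \<S>" by simp
qed

section \<open>Leftmost paths\<close>

lemma arithmetical_setI:
  assumes ACA "arithmetical p" "\<And>X. S X \<in> \<S>" "\<And>a. P a \<longleftrightarrow> sat M (e(x := a)) S p"
  shows "{a. P a} \<in> \<S>"
  using assms unfolding ACA_def by simp

context
  fixes T R :: "'a set"
  assumes ACA: ACA and T: "T \<in> \<S>" and R: "R \<in> \<S>"
    and nodes: "\<And>m. \<exists>a. pr m a \<in> T"
    and mono: "\<And>m n a. pr m a \<in> T \<Longrightarrow> n \<preceq> m \<Longrightarrow> pr n a \<in> T"
begin

text \<open>A node is a number \<open>a\<close>, standing for the 0-1 sequence \<open>p \<mapsto> [(a, p) \<in> R]\<close>; its level is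
  recorded by \<open>T\<close>. The same node may occur on many levels.\<close>

definition agree where "agree n a b \<longleftrightarrow> (\<forall>p. p \<prec> n \<longrightarrow> (pr a p \<in> R \<longleftrightarrow> pr b p \<in> R))"

text \<open>Concerns only the first \<open>n\<close> bits of \<open>a\<close>: they are shared by
  nodes on every level. The number \<open>a\<close> itself need not lie in \<open>T\<close>.\<close>

definition ext where "ext n a \<longleftrightarrow> (\<forall>m. \<exists>b. pr m b \<in> T \<and> agree n a b)"

text \<open>A bit 1 is allowed only where bit 0 after the same initial segment would not be
  extendible.\<close>

definition leftmost where
  "leftmost n a \<longleftrightarrow> ext n a \<and>
    (\<forall>i. i \<prec> n \<and> pr a i \<in> R \<longrightarrow> \<not> (\<exists>b. agree i a b \<and> pr b i \<notin> R \<and> ext (i \<oplus> \<one>) b))"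

lemma agree_sym: "agree n a b \<Longrightarrow> agree n b a"
  and agree_trans: "agree n a b \<Longrightarrow> agree n b c \<Longrightarrow> agree n a c"
  and agree_mono: "agree n a b \<Longrightarrow> m \<preceq> n \<Longrightarrow> agree m a b"
  and agree_succ: "agree (n \<oplus> \<one>) a b \<longleftrightarrow> agree n a b \<and> (pr a n \<in> R \<longleftrightarrow> pr b n \<in> R)"
  unfolding agree_def using ord.less_le_trans by (auto simp: less_succ)

lemma ext_mono: "ext n a \<Longrightarrow> m \<preceq> n \<Longrightarrow> ext m a"
  unfolding ext_def using agree_mono by blast

text \<open>Otherwise there are three nodes \<open>b\<close>, \<open>b'\<close>, \<open>c\<close>
  with the same first \<open>n\<close> bits that pairwise differ in bit \<open>n\<close>, which is
  impossible for 0-1 sequences.\<close>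

lemma ext_succ:
  assumes "ext n a"
  shows "\<exists>b. agree n a b \<and> ext (n \<oplus> \<one>) b"
proof (rule ccontr)
  assume "\<not> ?thesis"
  then have no: "\<exists>m. \<forall>c. pr m c \<in> T \<longrightarrow> \<not> agree (n \<oplus> \<one>) b c" if "agree n a b" for b
    using that unfolding ext_def by blast
  obtain b where b: "agree n a b" using assms unfolding ext_def by blast
  obtain m where m: "\<And>c. pr m c \<in> T \<Longrightarrow> \<not> agree (n \<oplus> \<one>) b c" using no[OF b] by blast
  \<comment> \<open>Taken on level \<open>m\<close>, where no node continues \<open>b\<close>; hence
    \<open>b'\<close> differs from \<open>b\<close> in bit \<open>n\<close>.\<close>
  obtain b' where b': "pr m b' \<in> T" "agree n a b'" using assms unfolding ext_def by blast
  obtain m' where m': "\<And>c. pr m' c \<in> T \<Longrightarrow> \<not> agree (n \<oplus> \<one>) b' c" using no[OF b'(2)] by blast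
  \<comment> \<open>By monotonicity this node also occurs on levels \<open>m\<close> and
    \<open>m'\<close>, so it continues neither \<open>b\<close> nor \<open>b'\<close>.\<close>
  obtain c where c: "pr (ord.max m m') c \<in> T" "agree n a c" using assms unfolding ext_def by blast
  have "pr m c \<in> T" "pr m' c \<in> T"
    using mono[OF c(1)] by auto
  then have "\<not> agree (n \<oplus> \<one>) b c" "\<not> agree (n \<oplus> \<one>) b' c" "\<not> agree (n \<oplus> \<one>) b b'"
    using m m' b'(1) by auto
  moreover have "agree n b c" "agree n b' c" "agree n b b'"
    using b b'(2) c(2) agree_sym agree_trans by blast+
  ultimately show False unfolding agree_succ by blast
qed

lemma leftmost_cong:
  assumes "leftmost n a" "agree n a b" "i \<prec> n" "pr b i \<in> R"
  shows "\<not> (\<exists>c. agree i b c \<and> pr c i \<notin> R \<and> ext (i \<oplus> \<one>) c)"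
proof -
  have "pr a i \<in> R" using assms unfolding agree_def by blast
  moreover have "agree i a b" using assms agree_mono by (auto simp: le_def)
  then have "agree i a c" if "agree i b c" for c using that agree_trans by blast
  ultimately show ?thesis using assms(1,3) unfolding leftmost_def by blast
qed

text \<open>Bit 0 is appended if some extendible continuation has it; otherwise any extendible
  continuation will do.\<close>

lemma leftmost_succ:
  assumes "leftmost n a"
  shows "\<exists>b. leftmost (n \<oplus> \<one>) b"
proof (cases "\<exists>b. agree n a b \<and> pr b n \<notin> R \<and> ext (n \<oplus> \<one>) b")
  case True
  then obtain b where b: "agree n a b" "pr b n \<notin> R" "ext (n \<oplus> \<one>) b" by blast
  have "\<not> (\<exists>c. agree i b c \<and> pr c i \<notin> R \<and> ext (i \<oplus> \<one>) c)" if "i \<prec> n \<oplus> \<one>" "pr b i \<in> R" for i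
    using that b leftmost_cong[OF assms b(1)] unfolding less_succ by auto
  with b(3) have "leftmost (n \<oplus> \<one>) b" unfolding leftmost_def by blast
  then show ?thesis by blast
next
  case False
  obtain b where b: "agree n a b" "ext (n \<oplus> \<one>) b"
    using ext_succ assms unfolding leftmost_def by blast
  have "\<not> (\<exists>c. agree i b c \<and> pr c i \<notin> R \<and> ext (i \<oplus> \<one>) c)" if "i \<prec> n \<oplus> \<one>" "pr b i \<in> R" for i
    using that(1) unfolding less_succ
  proof
    assume "i \<prec> n"
    then show ?thesis using leftmost_cong[OF assms b(1)] that by blast
  next
    assume "i = n"
    then show ?thesis using False agree_trans[OF b(1)] by blast
  qed
  with b(2) have "leftmost (n \<oplus> \<one>) b" unfolding leftmost_def by blast
  then show ?thesis by blast
qed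

lemma leftmost_mono: "leftmost n a \<Longrightarrow> m \<preceq> n \<Longrightarrow> leftmost m a"
  unfolding leftmost_def using ext_mono ord.less_le_trans by blast

text \<open>At the first difference one of the two sequences has bit 1, and the other one witnesses
  that bit 0 was extendible there.\<close>

lemma leftmost_agree:
  assumes "leftmost n a" "leftmost n b"
  shows "agree n a b"
proof (rule ccontr)
  assume "\<not> agree n a b"
  define A where "A = {p. p \<prec> n \<and> \<not> (pr a p \<in> R \<longleftrightarrow> pr b p \<in> R)}"
  obtain p where p: "p \<in> A" using \<open>\<not> agree n a b\<close> unfolding agree_def A_def by blast
  have A: "A \<in> \<S>"
    unfolding A_def
    by (rule Sigma00_setI[where x = "''p''" and e = "(\<lambda>_. n)(''a'' := a, ''b'' := b)"
        and S = "\<lambda>_. R" and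
        p = "NVar ''p'' \<^bold>< NVar ''n'' \<^bold>\<and>
          \<^bold>\<not> (\<^bold>\<langle>NVar ''a'', NVar ''p''\<^bold>\<rangle> \<^bold>\<in> ''R'' \<^bold>\<longleftrightarrow> \<^bold>\<langle>NVar ''b'', NVar ''p''\<^bold>\<rangle> \<^bold>\<in> ''R'')"])
      (use R in \<open>auto intro!: Sigma00.intros\<close>)
  obtain q where "q \<in> A" "\<And>x. x \<prec> q \<Longrightarrow> x \<notin> A" using set_least[OF A p] by blast
  then have q: "q \<prec> n" "\<not> (pr a q \<in> R \<longleftrightarrow> pr b q \<in> R)"
    "\<And>x. x \<prec> q \<Longrightarrow> x \<prec> n \<Longrightarrow> pr a x \<in> R \<longleftrightarrow> pr b x \<in> R"
    unfolding A_def by blast+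
  then have ab: "agree q a b" unfolding agree_def by (metis less_trans)
  have "q \<oplus> \<one> \<preceq> n" using q(1) by (simp add: succ_le_iff)
  then have "ext (q \<oplus> \<one>) a" "ext (q \<oplus> \<one>) b"
    using assms ext_mono unfolding leftmost_def by blast+
  then show False
    using assms q(1,2) ab agree_sym[OF ab] unfolding leftmost_def by blast
qed

lemma weak_koenig:
  "\<exists>F\<in>\<S>. \<forall>m. \<exists>a. pr m a \<in> T \<and> (\<forall>p. p \<prec> m \<longrightarrow> (p \<in> F \<longleftrightarrow> pr a p \<in> R))"
proof -
  define X where "X = {q. \<exists>n a. q = pr n a \<and> ext n a}"
  have X_iff: "ext n a \<longleftrightarrow> pr n a \<in> X" for n a unfolding X_def by auto
  have X: "X \<in> \<S>"
    unfolding X_def ext_def agree_def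
    by (rule arithmetical_setI[OF ACA, where x = "''q''" and S = "(\<lambda>_. T)(''R'' := R)" and p =
      "\<^bold>\<exists>''n''. \<^bold>\<exists>''a''. NVar ''q'' \<^bold>= \<^bold>\<langle>NVar ''n'', NVar ''a''\<^bold>\<rangle> \<^bold>\<and>
        (\<^bold>\<forall>''m''. \<^bold>\<exists>''b''. \<^bold>\<langle>NVar ''m'', NVar ''b''\<^bold>\<rangle> \<^bold>\<in> ''T'' \<^bold>\<and> (\<^bold>\<forall>''p''. NVar ''p'' \<^bold>< NVar ''n'' \<^bold>\<longrightarrow>
          (\<^bold>\<langle>NVar ''a'', NVar ''p''\<^bold>\<rangle> \<^bold>\<in> ''R'' \<^bold>\<longleftrightarrow> \<^bold>\<langle>NVar ''b'', NVar ''p''\<^bold>\<rangle> \<^bold>\<in> ''R'')))"])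
      (use T R in simp_all)
  define L where "L = {q. \<exists>n a. q = pr n a \<and> leftmost n a}"
  have L_iff: "leftmost n a \<longleftrightarrow> pr n a \<in> L" for n a unfolding L_def by auto
  have L: "L \<in> \<S>"
    unfolding L_def leftmost_def agree_def X_iff
    by (rule arithmetical_setI[OF ACA, where x = "''q''" and S = "(\<lambda>_. X)(''R'' := R)" and p =
      "\<^bold>\<exists>''n''. \<^bold>\<exists>''a''. NVar ''q'' \<^bold>= \<^bold>\<langle>NVar ''n'', NVar ''a''\<^bold>\<rangle> \<^bold>\<and> \<^bold>\<langle>NVar ''n'', NVar ''a''\<^bold>\<rangle> \<^bold>\<in> ''X'' \<^bold>\<and>
        (\<^bold>\<forall>''i''. NVar ''i'' \<^bold>< NVar ''n'' \<^bold>\<and> \<^bold>\<langle>NVar ''a'', NVar ''i''\<^bold>\<rangle> \<^bold>\<in> ''R'' \<^bold>\<longrightarrow>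
          \<^bold>\<not> (\<^bold>\<exists>''b''. (\<^bold>\<forall>''p''. NVar ''p'' \<^bold>< NVar ''i'' \<^bold>\<longrightarrow>
          (\<^bold>\<langle>NVar ''a'', NVar ''p''\<^bold>\<rangle> \<^bold>\<in> ''R'' \<^bold>\<longleftrightarrow> \<^bold>\<langle>NVar ''b'', NVar ''p''\<^bold>\<rangle> \<^bold>\<in> ''R'')) \<^bold>\<and>
          \<^bold>\<not> \<^bold>\<langle>NVar ''b'', NVar ''i''\<^bold>\<rangle> \<^bold>\<in> ''R'' \<^bold>\<and> \<^bold>\<langle>NVar ''i'' \<^bold>+ \<^bold>1, NVar ''b''\<^bold>\<rangle> \<^bold>\<in> ''X''))"])
      (use X R in simp_all)
  have all: "\<exists>a. leftmost n a" for n
  proof (induct n rule: induct)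
    show "{n. \<exists>a. leftmost n a} \<in> \<S>"
      unfolding L_iff
      by (rule arithmetical_setI[OF ACA, where x = "''n''" and S = "\<lambda>_. L" and p =
        "\<^bold>\<exists>''a''. \<^bold>\<langle>NVar ''n'', NVar ''a''\<^bold>\<rangle> \<^bold>\<in> ''L''"]) (use L in simp_all)
    show "\<exists>a. leftmost \<zero> a"
      using nodes unfolding leftmost_def ext_def agree_def by auto
    show "\<exists>a. leftmost (n \<oplus> \<one>) a" if "\<exists>a. leftmost n a" for n
      using that leftmost_succ by blast
  qed
  define F where "F = {p. \<exists>a. leftmost (p \<oplus> \<one>) a \<and> pr a p \<in> R}"
  have "F \<in> \<S>"
    unfolding F_def L_iff
    by (rule arithmetical_setI[OF ACA, where x = "''p''" and S = "(\<lambda>_. L)(''R'' := R)" and p =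
      "\<^bold>\<exists>''a''. \<^bold>\<langle>NVar ''p'' \<^bold>+ \<^bold>1, NVar ''a''\<^bold>\<rangle> \<^bold>\<in> ''L'' \<^bold>\<and> \<^bold>\<langle>NVar ''a'', NVar ''p''\<^bold>\<rangle> \<^bold>\<in> ''R''"])
      (use L R in simp_all)
  moreover have "\<exists>a. pr m a \<in> T \<and> (\<forall>p. p \<prec> m \<longrightarrow> (p \<in> F \<longleftrightarrow> pr a p \<in> R))" for m
  proof -
    obtain a where a: "leftmost m a" using all by blast
    \<comment> \<open>\<open>a\<close> need not be a node of level \<open>m\<close>; extendibility
      provides one with the same first \<open>m\<close> bits.\<close>
    then obtain b where b: "pr m b \<in> T" "agree m a b" unfolding leftmost_def ext_def by blast
    have "p \<in> F \<longleftrightarrow> pr b p \<in> R" if "p \<prec> m" for p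
    proof -
      have "leftmost (p \<oplus> \<one>) a" using leftmost_mono[OF a] that by (simp add: succ_le_iff)
      moreover from this have "pr a p \<in> R" if "leftmost (p \<oplus> \<one>) c" "pr c p \<in> R" for c
        using leftmost_agree[OF _ that(1)] that(2) unfolding agree_succ by blast
      ultimately have "p \<in> F \<longleftrightarrow> pr a p \<in> R" unfolding F_def by blast
      also have "\<dots> \<longleftrightarrow> pr b p \<in> R" using b(2) that unfolding agree_def by blast
      finally show ?thesis .
    qed
    with b(1) show ?thesis by blast
  qed
  ultimately show ?thesis by blast
qed

end

section \<open>Coding of bounded sets\<close>

abbreviation divides (infix \<open>\<bar>\<close> 50) where "a \<bar> b \<equiv> dvd.dvd (\<otimes>) a b"

text \<open>If \<open>d\<close> is a common multiple of \<open>1, \<dots>, b\<close>, the numbers \<open>modulus d p\<close> with \<open>p < b\<close> are pairwise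
  coprime (this is Goedel's beta function), so the product of those with \<open>p \<in> A\<close> codes
  \<open>A \<inter> {p. p < b}\<close> by divisibility.\<close>

definition modulus where "modulus d p = \<one> \<oplus> (p \<oplus> \<one>) \<otimes> d"

text \<open>Modulo \<open>modulus d p\<close> the product \<open>(p + 1) * d\<close> is -1, so
  \<open>d\<close> is invertible.\<close>

lemma modulus_cancel:
  assumes "modulus d p \<bar> y \<otimes> d"
  shows "modulus d p \<bar> y"
proof -
  have "modulus d p \<bar> (p \<oplus> \<one>) \<otimes> (y \<otimes> d)" using assms by (rule mn.dvd_mult)
  moreover have "y \<otimes> modulus d p = (p \<oplus> \<one>) \<otimes> (y \<otimes> d) \<oplus> y"
    by (simp add: modulus_def algebra_simps)
  then have "modulus d p \<bar> (p \<oplus> \<one>) \<otimes> (y \<otimes> d) \<oplus> y" by (metis mn.dvd_triv_right)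
  ultimately show ?thesis using mn.dvd_add_right_iff by blast
qed

text \<open>Two moduli differ by \<open>(t + 1) * d\<close>, where \<open>t + 1\<close> is the
  distance of the indices and divides \<open>d\<close>. Cancelling \<open>d\<close>, completing
  \<open>t + 1\<close> to \<open>d\<close> and cancelling again leaves \<open>c\<close>.\<close>

lemma modulus_coprime:
  assumes d: "\<And>t. t \<prec> b \<Longrightarrow> t \<oplus> \<one> \<bar> d" and "i \<prec> b" "n \<prec> b" "i \<noteq> n"
    and dvd: "modulus d i \<bar> c \<otimes> modulus d n"
  shows "modulus d i \<bar> c"
proof -
  have *: "modulus d i \<bar> c" if t: "t \<prec> b" and "modulus d i \<bar> (c \<otimes> (t \<oplus> \<one>)) \<otimes> d" for t
  proof -
    obtain e where e: "d = (t \<oplus> \<one>) \<otimes> e" using d[OF t] by (rule mn.dvdE)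
    have "modulus d i \<bar> c \<otimes> (t \<oplus> \<one>)" using that(2) by (rule modulus_cancel)
    then have "modulus d i \<bar> (c \<otimes> (t \<oplus> \<one>)) \<otimes> e" by (rule mn.dvd_mult2)
    then have "modulus d i \<bar> c \<otimes> d" by (simp add: e mult_assoc)
    then show ?thesis by (rule modulus_cancel)
  qed
  have shift: "modulus d (p \<oplus> (t \<oplus> \<one>)) = modulus d p \<oplus> (t \<oplus> \<one>) \<otimes> d" for p t
    by (simp add: modulus_def algebra_simps)
  have less: "t \<prec> p \<oplus> (t \<oplus> \<one>)" for p t
    using less_add_succ[of t p] by (simp add: ac_simps)
  from less_linear[of i n] \<open>i \<noteq> n\<close> consider "i \<prec> n" | "n \<prec> i" by blast
  then show ?thesis
  proof cases
    case 1
    then obtain t where t: "n = i \<oplus> (t \<oplus> \<one>)" by (auto simp: less_iff)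
    have "c \<otimes> modulus d n = c \<otimes> modulus d i \<oplus> (c \<otimes> (t \<oplus> \<one>)) \<otimes> d"
      unfolding t shift by (simp add: algebra_simps)
    then have "modulus d i \<bar> (c \<otimes> (t \<oplus> \<one>)) \<otimes> d"
      using dvd mn.dvd_add_right_iff mn.dvd_triv_right by metis
    moreover have "t \<prec> b" using less[of t i] t \<open>n \<prec> b\<close> less_trans by blast
    ultimately show ?thesis using * by blast
  next
    case 2
    then obtain t where t: "i = n \<oplus> (t \<oplus> \<one>)" by (auto simp: less_iff)
    have "c \<otimes> modulus d i = c \<otimes> modulus d n \<oplus> (c \<otimes> (t \<oplus> \<one>)) \<otimes> d"
      unfolding t shift by (simp add: algebra_simps)
    then have "modulus d i \<bar> (c \<otimes> (t \<oplus> \<one>)) \<otimes> d"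
      using dvd mn.dvd_add_right_iff mn.dvd_triv_right by metis
    moreover have "t \<prec> b" using less[of t n] t \<open>i \<prec> b\<close> less_trans by blast
    ultimately show ?thesis using * by blast
  qed
qed

lemma modulus_not_dvd_one:
  assumes "d \<noteq> \<zero>"
  shows "\<not> modulus d p \<bar> \<one>"
proof
  assume "modulus d p \<bar> \<one>"
  then obtain q where q: "\<one> = modulus d p \<otimes> q" by (rule mn.dvdE)
  then have "q \<noteq> \<zero>" by auto
  then have "modulus d p \<preceq> modulus d p \<otimes> q"
    using zero_or_succ[of q] by (auto simp: mult_succ mn.add_increasing)
  then have "\<one> \<oplus> (p \<oplus> \<one>) \<otimes> d \<preceq> \<one> \<oplus> \<zero>"
    unfolding q[symmetric] unfolding modulus_def add_zero .
  then have "(p \<oplus> \<one>) \<otimes> d \<preceq> \<zero>" by (metis mn.add_le_cancel_left)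
  then have "(p \<oplus> \<one>) \<otimes> d = \<zero>" by (simp add: le_def)
  then show False using assms by (simp add: mn.mult_eq_0_iff)
qed

text \<open>Stands in for the factorial: proving existence by induction avoids defining a recursive
  function inside the model.\<close>

lemma common_multiple:
  assumes ACA: ACA
  shows "\<exists>d. d \<noteq> \<zero> \<and> (\<forall>t. t \<prec> b \<longrightarrow> t \<oplus> \<one> \<bar> d)"
proof (induct b rule: induct)
  show "{b. \<exists>d. d \<noteq> \<zero> \<and> (\<forall>t. t \<prec> b \<longrightarrow> t \<oplus> \<one> \<bar> d)} \<in> \<S>"
    unfolding mn.dvd_def
    by (rule arithmetical_setI[OF ACA, where x = "''b''" and S = "\<lambda>_. UNIV" and p =
      "\<^bold>\<exists>''d''. \<^bold>\<not> NVar ''d'' \<^bold>= \<^bold>0 \<^bold>\<and> (\<^bold>\<forall>''t''. NVar ''t'' \<^bold>< NVar ''b'' \<^bold>\<longrightarrow>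
        (\<^bold>\<exists>''q''. NVar ''d'' \<^bold>= (NVar ''t'' \<^bold>+ \<^bold>1) \<^bold>* NVar ''q''))"]) simp_all
  show "\<exists>d. d \<noteq> \<zero> \<and> (\<forall>t. t \<prec> \<zero> \<longrightarrow> t \<oplus> \<one> \<bar> d)"
    by (intro exI[of _ \<one>]) simp
  fix b assume "\<exists>d. d \<noteq> \<zero> \<and> (\<forall>t. t \<prec> b \<longrightarrow> t \<oplus> \<one> \<bar> d)"
  then obtain d where "d \<noteq> \<zero>" "\<And>t. t \<prec> b \<Longrightarrow> t \<oplus> \<one> \<bar> d" by blast
  then show "\<exists>d. d \<noteq> \<zero> \<and> (\<forall>t. t \<prec> b \<oplus> \<one> \<longrightarrow> t \<oplus> \<one> \<bar> d)"
    by (intro exI[of _ "d \<otimes> (b \<oplus> \<one>)"]) (auto simp: less_succ mn.mult_eq_0_iff intro: mn.dvd_mult2)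
qed

lemma bounded_code:
  assumes ACA: ACA and A: "A \<in> \<S>"
  shows "\<exists>c d. \<forall>p. p \<prec> b \<longrightarrow> (p \<in> A \<longleftrightarrow> modulus d p \<bar> c)"
proof -
  obtain d where d: "d \<noteq> \<zero>" "\<And>t. t \<prec> b \<Longrightarrow> t \<oplus> \<one> \<bar> d"
    using common_multiple[OF ACA] by blast
  \<comment> \<open>The elements of \<open>A\<close> are collected one by one up to
    \<open>n\<close>, while \<open>b\<close> and hence \<open>d\<close> stay fixed so that all
    moduli remain coprime. The code 1 stands for the empty set.\<close>
  have "\<exists>c. \<forall>p. p \<prec> b \<longrightarrow> (p \<in> A \<and> p \<prec> n \<longleftrightarrow> modulus d p \<bar> c)" for n
  proof (induct n rule: induct)
    show "{n. \<exists>c. \<forall>p. p \<prec> b \<longrightarrow> (p \<in> A \<and> p \<prec> n \<longleftrightarrow> modulus d p \<bar> c)} \<in> \<S>"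
      unfolding mn.dvd_def modulus_def
      by (rule arithmetical_setI[OF ACA, where x = "''n''" and e = "(\<lambda>_. b)(''d'' := d)"
          and S = "\<lambda>_. A" and p =
        "\<^bold>\<exists>''c''. \<^bold>\<forall>''p''. NVar ''p'' \<^bold>< NVar ''b'' \<^bold>\<longrightarrow> (NVar ''p'' \<^bold>\<in> ''A'' \<^bold>\<and> NVar ''p'' \<^bold>< NVar ''n'' \<^bold>\<longleftrightarrow>
          (\<^bold>\<exists>''q''. NVar ''c'' \<^bold>= (\<^bold>1 \<^bold>+ (NVar ''p'' \<^bold>+ \<^bold>1) \<^bold>* NVar ''d'') \<^bold>* NVar ''q''))"])
              (use A in simp_all)
    show "\<exists>c. \<forall>p. p \<prec> b \<longrightarrow> (p \<in> A \<and> p \<prec> \<zero> \<longleftrightarrow> modulus d p \<bar> c)"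
      using modulus_not_dvd_one[OF d(1)] by (intro exI[of _ \<one>]) simp
    fix n assume "\<exists>c. \<forall>p. p \<prec> b \<longrightarrow> (p \<in> A \<and> p \<prec> n \<longleftrightarrow> modulus d p \<bar> c)"
    then obtain c where c: "\<And>p. p \<prec> b \<Longrightarrow> p \<in> A \<and> p \<prec> n \<longleftrightarrow> modulus d p \<bar> c" by blast
    show "\<exists>c. \<forall>p. p \<prec> b \<longrightarrow> (p \<in> A \<and> p \<prec> n \<oplus> \<one> \<longleftrightarrow> modulus d p \<bar> c)"
    proof (cases "n \<in> A \<and> n \<prec> b")
      case True
      have "p \<in> A \<and> p \<prec> n \<oplus> \<one> \<longleftrightarrow> modulus d p \<bar> c \<otimes> modulus d n" if "p \<prec> b" for p
      proof (cases "p = n")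
        case False
        have "modulus d p \<bar> c \<otimes> modulus d n \<longleftrightarrow> modulus d p \<bar> c"
          using modulus_coprime[OF d(2) that _ False] True mn.dvd_mult2 by blast
        with c[OF that] False show ?thesis by (simp add: less_succ)
      qed (use True in \<open>simp add: less_succ\<close>)
      then show ?thesis by blast
    next
      case False
      then have "p \<in> A \<and> p \<prec> n \<oplus> \<one> \<longleftrightarrow> p \<in> A \<and> p \<prec> n" if "p \<prec> b" for p
        using that by (auto simp: less_succ)
      with c show ?thesis by blast
    qed
  qed
  from this[of b] show ?thesis by blast
qed

section \<open>Arithmetical comprehension implies compactness\<close>

context
  fixes k :: nat and good V C
  assumes ACA: ACA and good: "good_notion good" and V: "V \<in> \<S>" and C: "C \<in> \<S>"
    and hyp: "hypergraph V C"
    and fin: "\<And>W E. W \<in> \<S> \<Longrightarrow> E \<in> \<S> \<Longrightarrow> W \<subseteq> V \<Longrightarrow> bounded W \<Longrightarrow> bounded E \<Longrightarrow>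
      (\<And>i. i \<in> E \<Longrightarrow> edge C i \<subseteq> W) \<Longrightarrow>
      \<exists>F\<in>\<S>. coloring k F W \<and> (\<forall>i\<in>E. good F (edge C i))"
begin

text \<open>The bit relation for the path argument: a node is the pair of a product \<open>c\<close>
  and the parameter \<open>d\<close> of its moduli.\<close>

definition bits where "bits = {x. \<exists>c d p. x = pr (pr c d) p \<and> modulus d p \<bar> c}"

text \<open>The cutoff leaves existence and uniqueness of the color of each vertex as the only
  functional requirements to be imposed by \<open>levels\<close>.\<close>

definition decoded where "decoded a = {p. \<exists>v j. p = pr v j \<and> v \<in> V \<and> j \<prec> num k \<and> pr a p \<in> bits}"

definition decoded_graph where "decoded_graph = {x. \<exists>a p. x = pr a p \<and> p \<in> decoded a}"

definition good_pairs where "good_pairs = {x. \<exists>a i. x = pr a i \<and> good (decoded a) (edge C i)}"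

text \<open>Edges reaching beyond \<open>m\<close> are exempt, so level \<open>m\<close> is a
  condition on the vertices below \<open>m\<close>. This makes the hypothesis on finite parts
  applicable and makes the levels decreasing.\<close>

definition levels where
  "levels = {x. \<exists>m a. x = pr m a \<and>
    (\<forall>v. v \<prec> m \<and> v \<in> V \<longrightarrow> (\<exists>j. pr v j \<in> decoded a \<and> (\<forall>z. pr v z \<in> decoded a \<longrightarrow> z = j))) \<and>
    (\<forall>i. i \<prec> m \<and> (\<forall>v. v \<in> edge C i \<longrightarrow> v \<prec> m) \<longrightarrow> good (decoded a) (edge C i))}"

lemma set_bits: "bits \<in> \<S>"
  unfolding bits_def mn.dvd_def modulus_def
  by (rule arithmetical_setI[OF ACA, where x = "''x''" and S = "\<lambda>_. UNIV" and p =
    "\<^bold>\<exists>''c''. \<^bold>\<exists>''d''. \<^bold>\<exists>''p''. NVar ''x'' \<^bold>= \<^bold>\<langle>\<^bold>\<langle>NVar ''c'', NVar ''d''\<^bold>\<rangle>, NVar ''p''\<^bold>\<rangle> \<^bold>\<and>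
      (\<^bold>\<exists>''q''. NVar ''c'' \<^bold>= (\<^bold>1 \<^bold>+ (NVar ''p'' \<^bold>+ \<^bold>1) \<^bold>* NVar ''d'') \<^bold>* NVar ''q'')"])
    simp_all

lemma set_decoded_graph: "decoded_graph \<in> \<S>"
  unfolding decoded_graph_def decoded_def mem_Collect_eq
  by (rule arithmetical_setI[OF ACA, where x = "''x''" and S = "(\<lambda>_. V)(''B'' := bits)" and p =
    "\<^bold>\<exists>''a''. \<^bold>\<exists>''p''. NVar ''x'' \<^bold>= \<^bold>\<langle>NVar ''a'', NVar ''p''\<^bold>\<rangle> \<^bold>\<and>
      (\<^bold>\<exists>''v''. \<^bold>\<exists>''j''. NVar ''p'' \<^bold>= \<^bold>\<langle>NVar ''v'', NVar ''j''\<^bold>\<rangle> \<^bold>\<and> NVar ''v'' \<^bold>\<in> ''V'' \<^bold>\<and>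
        NVar ''j'' \<^bold>< numeral_tm k \<^bold>\<and> \<^bold>\<langle>NVar ''a'', NVar ''p''\<^bold>\<rangle> \<^bold>\<in> ''B'')"])
    (use V set_bits in simp_all)

lemma decoded_iff: "p \<in> decoded a \<longleftrightarrow> pr a p \<in> decoded_graph"
  unfolding decoded_graph_def by auto

lemma set_good_pairs: "good_pairs \<in> \<S>"
proof -
  have "{x. \<exists>a i. x = pr a i \<and> proper (decoded a) (edge C i)} \<in> \<S>"
    unfolding proper_def edge_def decoded_iff mem_Collect_eq
    by (rule arithmetical_setI[OF ACA, where x = "''x''" and S = "(\<lambda>_. C)(''K'' := decoded_graph)"
        and p =
      "\<^bold>\<exists>''a''. \<^bold>\<exists>''i''. NVar ''x'' \<^bold>= \<^bold>\<langle>NVar ''a'', NVar ''i''\<^bold>\<rangle> \<^bold>\<and>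
        ((\<^bold>\<exists>''u''. \<^bold>\<exists>''v''. in_edge_fm (NVar ''u'') (NVar ''i'') \<^bold>\<and>
            in_edge_fm (NVar ''v'') (NVar ''i'') \<^bold>\<and>
           \<^bold>\<not> NVar ''u'' \<^bold>= NVar ''v'') \<^bold>\<longrightarrow>
         (\<^bold>\<exists>''u''. \<^bold>\<exists>''v''. \<^bold>\<exists>''c''. \<^bold>\<exists>''d''. in_edge_fm (NVar ''u'') (NVar ''i'') \<^bold>\<and>
             in_edge_fm (NVar ''v'') (NVar ''i'') \<^bold>\<and>
           \<^bold>\<langle>NVar ''a'', \<^bold>\<langle>NVar ''u'', NVar ''c''\<^bold>\<rangle>\<^bold>\<rangle> \<^bold>\<in> ''K'' \<^bold>\<and>
               \<^bold>\<langle>NVar ''a'', \<^bold>\<langle>NVar ''v'', NVar ''d''\<^bold>\<rangle>\<^bold>\<rangle> \<^bold>\<in> ''K'' \<^bold>\<and>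
           \<^bold>\<not> NVar ''c'' \<^bold>= NVar ''d''))"])
      (use C set_decoded_graph in \<open>simp_all add: in_edge_fm_def\<close>)
  moreover have "{x. \<exists>a i. x = pr a i \<and> conflict_free (decoded a) (edge C i)} \<in> \<S>"
    unfolding conflict_free_def edge_def decoded_iff mem_Collect_eq
    by (rule arithmetical_setI[OF ACA, where x = "''x''" and S = "(\<lambda>_. C)(''K'' := decoded_graph)"
        and p =
      "\<^bold>\<exists>''a''. \<^bold>\<exists>''i''. NVar ''x'' \<^bold>= \<^bold>\<langle>NVar ''a'', NVar ''i''\<^bold>\<rangle> \<^bold>\<and>
        (\<^bold>\<exists>''j''. \<^bold>\<exists>''v''. in_edge_fm (NVar ''v'') (NVar ''i'') \<^bold>\<and>
            \<^bold>\<langle>NVar ''a'', \<^bold>\<langle>NVar ''v'', NVar ''j''\<^bold>\<rangle>\<^bold>\<rangle> \<^bold>\<in> ''K'' \<^bold>\<and>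
          (\<^bold>\<forall>''u''. in_edge_fm (NVar ''u'') (NVar ''i'') \<^bold>\<and>
              \<^bold>\<langle>NVar ''a'', \<^bold>\<langle>NVar ''u'', NVar ''j''\<^bold>\<rangle>\<^bold>\<rangle> \<^bold>\<in> ''K'' \<^bold>\<longrightarrow>
            NVar ''u'' \<^bold>= NVar ''v''))"])
      (use C set_decoded_graph in \<open>simp_all add: in_edge_fm_def\<close>)
  ultimately show ?thesis using good unfolding good_notion_def good_pairs_def by auto
qed

lemma good_iff: "good (decoded a) (edge C i) \<longleftrightarrow> pr a i \<in> good_pairs"
  unfolding good_pairs_def by auto

lemma set_levels: "levels \<in> \<S>"
  unfolding levels_def good_iff unfolding decoded_iff edge_def mem_Collect_eq
  by (rule arithmetical_setI[OF ACA, where x = "''x''"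
      and S = "(\<lambda>_. C)(''K'' := decoded_graph, ''G'' := good_pairs, ''V'' := V)" and p =
    "\<^bold>\<exists>''m''. \<^bold>\<exists>''a''. NVar ''x'' \<^bold>= \<^bold>\<langle>NVar ''m'', NVar ''a''\<^bold>\<rangle> \<^bold>\<and>
      (\<^bold>\<forall>''v''. NVar ''v'' \<^bold>< NVar ''m'' \<^bold>\<and> NVar ''v'' \<^bold>\<in> ''V'' \<^bold>\<longrightarrow>
        (\<^bold>\<exists>''j''. \<^bold>\<langle>NVar ''a'', \<^bold>\<langle>NVar ''v'', NVar ''j''\<^bold>\<rangle>\<^bold>\<rangle> \<^bold>\<in> ''K'' \<^bold>\<and>
          (\<^bold>\<forall>''z''. \<^bold>\<langle>NVar ''a'', \<^bold>\<langle>NVar ''v'', NVar ''z''\<^bold>\<rangle>\<^bold>\<rangle> \<^bold>\<in> ''K'' \<^bold>\<longrightarrow> NVar ''z'' \<^bold>= NVar ''j''))) \<^bold>\<and>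
      (\<^bold>\<forall>''i''. NVar ''i'' \<^bold>< NVar ''m'' \<^bold>\<and> (\<^bold>\<forall>''v''. in_edge_fm (NVar ''v'') (NVar ''i'') \<^bold>\<longrightarrow>
          NVar ''v'' \<^bold>< NVar ''m'') \<^bold>\<longrightarrow>
        \<^bold>\<langle>NVar ''a'', NVar ''i''\<^bold>\<rangle> \<^bold>\<in> ''G'')"])
    (use C V set_decoded_graph set_good_pairs in \<open>simp_all add: in_edge_fm_def\<close>)

lemma levels_iff: "pr m a \<in> levels \<longleftrightarrow>
    (\<forall>v. v \<prec> m \<and> v \<in> V \<longrightarrow> (\<exists>j. pr v j \<in> decoded a \<and> (\<forall>z. pr v z \<in> decoded a \<longrightarrow> z = j))) \<and>
    (\<forall>i. i \<prec> m \<and> (\<forall>v. v \<in> edge C i \<longrightarrow> v \<prec> m) \<longrightarrow> good (decoded a) (edge C i))"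
  unfolding levels_def by auto

lemma levels_mono:
  assumes "pr m a \<in> levels" "n \<preceq> m"
  shows "pr n a \<in> levels"
proof -
  have "x \<prec> m" if "x \<prec> n" for x using that assms(2) by (rule ord.less_le_trans)
  then show ?thesis using assms(1) unfolding levels_iff by meson
qed

lemma edge_subset: "edge C i \<subseteq> V"
  using hyp unfolding hypergraph_def by blast

lemma levels_nonempty: "\<exists>a. pr m a \<in> levels"
proof -
  define W where "W = {v. v \<in> V \<and> v \<prec> m}"
  define E where "E = {i. i \<prec> m \<and> (\<forall>v. v \<in> edge C i \<longrightarrow> v \<prec> m)}"
  have "W \<in> \<S>"
    unfolding W_def
    by (rule arithmetical_setI[OF ACA, where x = "''v''" and e = "\<lambda>_. m" and S = "\<lambda>_. V" and p =
      "NVar ''v'' \<^bold>\<in> ''V'' \<^bold>\<and> NVar ''v'' \<^bold>< NVar ''m''"]) (use V in simp_all)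
  moreover have "E \<in> \<S>"
    unfolding E_def edge_def mem_Collect_eq
    by (rule arithmetical_setI[OF ACA, where x = "''i''" and e = "\<lambda>_. m" and S = "\<lambda>_. C" and p =
      "NVar ''i'' \<^bold>< NVar ''m'' \<^bold>\<and> (\<^bold>\<forall>''v''. in_edge_fm (NVar ''v'') (NVar ''i'') \<^bold>\<longrightarrow>
          NVar ''v'' \<^bold>< NVar ''m'')"])
      (use C in \<open>simp_all add: in_edge_fm_def\<close>)
  moreover have "edge C i \<subseteq> W" if "i \<in> E" for i
    using that edge_subset unfolding E_def W_def by blast
  ultimately obtain F where F: "F \<in> \<S>" "coloring k F W" "\<And>i. i \<in> E \<Longrightarrow> good F (edge C i)"
    using fin[of W E] unfolding W_def E_def bounded_def by blast
  \<comment> \<open>Every code \<open>pr v j\<close> with \<open>v\<close> below \<open>m\<close>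
    and \<open>j\<close> below \<open>k\<close> is smaller than \<open>pr m (num k)\<close>.\<close>
  obtain c d where code: "\<And>p. p \<prec> pr m (num k) \<Longrightarrow> p \<in> F \<longleftrightarrow> modulus d p \<bar> c"
    using bounded_code[OF ACA F(1)] by blast
  have bits: "pr (pr c d) p \<in> bits \<longleftrightarrow> modulus d p \<bar> c" for p unfolding bits_def by auto
  have decoded: "pr v j \<in> decoded (pr c d) \<longleftrightarrow> pr v j \<in> F" if "v \<in> W" for v j
  proof (cases "j \<prec> num k")
    case True
    with that have "pr v j \<prec> pr m (num k)" unfolding W_def by (intro pr_less) auto
    then show ?thesis using that True code unfolding decoded_def bits W_def by auto
  next
    case False
    then have "pr v j \<notin> F" using F(2) unfolding coloring_def by blast
    with False show ?thesis unfolding decoded_def by auto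
  qed
  have "pr m (pr c d) \<in> levels"
    unfolding levels_iff
  proof (intro conjI allI impI)
    fix v assume "v \<prec> m \<and> v \<in> V"
    then have v: "v \<in> W" unfolding W_def by blast
    then show "\<exists>j. pr v j \<in> decoded (pr c d) \<and> (\<forall>z. pr v z \<in> decoded (pr c d) \<longrightarrow> z = j)"
      unfolding decoded[OF v] using F(2) unfolding coloring_def by blast
  next
    fix i assume i: "i \<prec> m \<and> (\<forall>v. v \<in> edge C i \<longrightarrow> v \<prec> m)"
    then have "good F (edge C i)" using F(3) unfolding E_def by blast
    moreover have "pr v j \<in> F \<longleftrightarrow> pr v j \<in> decoded (pr c d)" if "v \<in> edge C i" for v j
    proof -
      have "v \<in> W" using i that edge_subset unfolding W_def by blast
      then show ?thesis using decoded by simp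
    qed
    ultimately show "good (decoded (pr c d)) (edge C i)" using good_cong[OF good] by blast
  qed
  then show ?thesis by blast
qed

lemma colorable: "\<exists>F\<in>\<S>. coloring k F V \<and> (\<forall>i. good F (edge C i))"
proof -
  obtain F0 where F0: "F0 \<in> \<S>"
    "\<And>m. \<exists>a. pr m a \<in> levels \<and> (\<forall>p. p \<prec> m \<longrightarrow> (p \<in> F0 \<longleftrightarrow> pr a p \<in> bits))"
  proof -
    have "\<exists>F\<in>\<S>. \<forall>m. \<exists>a. pr m a \<in> levels \<and> (\<forall>p. p \<prec> m \<longrightarrow> (p \<in> F \<longleftrightarrow> pr a p \<in> bits))"
      by (rule weak_koenig[OF ACA set_levels set_bits levels_nonempty]) (rule levels_mono)
    then show ?thesis using that by blast
  qed
  \<comment> \<open>The path may contain numbers that are not codes of a vertex and an admissible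
    color; they are removed just as in \<open>decoded\<close>.\<close>
  define F where "F = {p. \<exists>v j. p = pr v j \<and> v \<in> V \<and> j \<prec> num k \<and> p \<in> F0}"
  have "F \<in> \<S>"
    unfolding F_def
    by (rule arithmetical_setI[OF ACA, where x = "''p''" and S = "(\<lambda>_. V)(''F'' := F0)" and p =
      "\<^bold>\<exists>''v''. \<^bold>\<exists>''j''. NVar ''p'' \<^bold>= \<^bold>\<langle>NVar ''v'', NVar ''j''\<^bold>\<rangle> \<^bold>\<and> NVar ''v'' \<^bold>\<in> ''V'' \<^bold>\<and>
        NVar ''j'' \<^bold>< numeral_tm k \<^bold>\<and> NVar ''p'' \<^bold>\<in> ''F''"]) (use V F0(1) in simp_all)
  have approx: "\<exists>a m. b \<preceq> m \<and> i \<prec> m \<and> pr m a \<in> levels \<and>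
      (\<forall>v j. v \<prec> b \<longrightarrow> (pr v j \<in> decoded a \<longleftrightarrow> pr v j \<in> F))" for b i
  proof -
    \<comment> \<open>Chosen above all codes of colored vertices below \<open>b\<close>, and above
      \<open>i\<close>, so that one node decides all these colors and the edge with index
      \<open>i\<close>.\<close>
    let ?m = "pr b (num k) \<oplus> (i \<oplus> \<one>)"
    obtain a where a: "pr ?m a \<in> levels" "\<And>p. p \<prec> ?m \<Longrightarrow> p \<in> F0 \<longleftrightarrow> pr a p \<in> bits"
      using F0(2) by blast
    have le: "pr b (num k) \<preceq> ?m" by (auto simp: le_iff)
    then have "b \<preceq> ?m" using fst_le_pr ord.order_trans by blast
    moreover have "i \<prec> ?m" using less_add_succ[of i "pr b (num k)"] by (simp add: ac_simps)
    moreover have "pr v j \<in> decoded a \<longleftrightarrow> pr v j \<in> F" if "v \<prec> b" for v j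
    proof -
      have "pr v j \<in> F0 \<longleftrightarrow> pr a (pr v j) \<in> bits" if "j \<prec> num k"
        using a(2) pr_less[OF \<open>v \<prec> b\<close> that] le ord.less_le_trans by blast
      then show ?thesis unfolding decoded_def F_def by auto
    qed
    ultimately show ?thesis using a(1) by blast
  qed
  have "coloring k F V"
    unfolding coloring_def
  proof (intro conjI ballI allI impI)
    show "\<exists>x y. x \<in> V \<and> p = pr x y" if "p \<in> F" for p using that unfolding F_def by blast
    show "c \<prec> num k" if "pr v c \<in> F" for v c using that unfolding F_def by auto
    fix v assume v: "v \<in> V"
    obtain a m where a: "v \<oplus> \<one> \<preceq> m" "pr m a \<in> levels"
      "\<And>u j. u \<prec> v \<oplus> \<one> \<Longrightarrow> pr u j \<in> decoded a \<longleftrightarrow> pr u j \<in> F"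
      using approx by meson
    then have "v \<prec> m" by (simp add: succ_le_iff)
    with a(2) v have "\<exists>j. pr v j \<in> decoded a \<and> (\<forall>z. pr v z \<in> decoded a \<longrightarrow> z = j)"
      unfolding levels_iff by blast
    then show "\<exists>y. pr v y \<in> F \<and> (\<forall>z. pr v z \<in> F \<longrightarrow> z = y)"
      using a(3)[of v] by (simp add: less_succ)
  qed
  moreover have "good F (edge C i)" for i
  proof -
    obtain b where b: "\<And>v. v \<in> edge C i \<Longrightarrow> v \<prec> b"
      using hyp unfolding hypergraph_def bounded_def by blast
    obtain a m where a: "b \<preceq> m" "i \<prec> m" "pr m a \<in> levels"
      "\<And>v j. v \<prec> b \<Longrightarrow> pr v j \<in> decoded a \<longleftrightarrow> pr v j \<in> F"
      using approx by meson
    have "\<forall>v. v \<in> edge C i \<longrightarrow> v \<prec> m" using b a(1) ord.less_le_trans by blast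
    then have "good (decoded a) (edge C i)" using a(2,3) unfolding levels_iff by blast
    moreover have "pr v j \<in> decoded a \<longleftrightarrow> pr v j \<in> F" if "v \<in> edge C i" for v j
      using a(4) b[OF that] by blast
    ultimately show ?thesis using good_cong[OF good] by blast
  qed
  ultimately show ?thesis using \<open>F \<in> \<S>\<close> by blast
qed

end

lemma compact_if_ACA:
  assumes ACA "good_notion good"
  shows "compact k good"
  unfolding compact_def
proof (intro ballI impI)
  fix V C assume "V \<in> \<S>" "C \<in> \<S>" "hypergraph V C" and
    "\<forall>W\<in>\<S>. \<forall>E\<in>\<S>. W \<subseteq> V \<and> bounded W \<and> bounded E \<and> (\<forall>i\<in>E. edge C i \<subseteq> W) \<longrightarrow>
      (\<exists>F\<in>\<S>. coloring k F W \<and> (\<forall>i\<in>E. good F (edge C i)))"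
  then show "\<exists>F\<in>\<S>. coloring k F V \<and> (\<forall>i. good F (edge C i))"
    by (intro colorable[OF assms]) blast+
qed

lemma ACA0_iff_compact:
  assumes "k \<ge> 2" "good_notion good"
  shows "M \<TTurnstile> ACA0 \<longleftrightarrow> compact k good"
  using compact_if_ACA[OF _ assms(2)] Sigma01_closed_if_compact[OF assms] ACA_if_Sigma01_closed
  unfolding ACA0_iff by blast

end

theorem theorem9:
  fixes k :: nat and M :: "'a l2_struct"
  assumes "k \<ge> 2"
    and "l2_structure M"
    and "M \<TTurnstile> RCA0"
  shows "(M \<TTurnstile> ACA0 \<longleftrightarrow> M \<Turnstile> proper_compactness k) \<and>
         (M \<TTurnstile> ACA0 \<longleftrightarrow> M \<Turnstile> conflict_free_compactness k) \<and>
         (M \<Turnstile> proper_compactness k \<longleftrightarrow> M \<Turnstile> conflict_free_compactness k)"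
proof -
  interpret rca0 M using assms(2,3) by unfold_locales
  show ?thesis
    using ACA0_iff_compact[OF assms(1)] proper_compactness_iff conflict_free_compactness_iff
    unfolding good_notion_def by blast
qed

end
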